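(* There is a universal constant $C\in(0,\infty)$ with the following property. Let $p\in[2,\infty)$, $n\in\mathbb N$, $k\in[n]$, and let $m\in\mathbb N$ satisfy $m\ge\sqrt{n/k}$. For every measure space $(M,\nu)$ and every mapping $f:\mathbb Z_{8m}^n\to L_p(M,\nu)$, over either the real or the complex scalar field, $$\left(\binom nk^{-1}\sum_{\substack{S\subseteq[n]\\|S|=k}}\mathbb E_{x,\varepsilon}\|f(x+4m\varepsilon_S)-f(x)\|_{L_p(M)}^p\right)^{1/p}\le C\frac p{\log p}\,m\left[\frac kn\sum_{j=1}^n\mathbb E_x\|f(x+e_j)-f(x)\|_{L_p(M)}^p+\left(\frac kn\right)^{p/2}\mathbb E_{x,\varepsilon}\|f(x+\varepsilon)-f(x)\|_{L_p(M)}^p\right]^{1/p}.$$ Moreover, the order $p/\log p$ cannot be improved up to universal factors: there is a universal constant $c>0$ such that, for every $p\in[2,\infty)$, if $K\in[0,\infty)$ is such that $$\left(\binom nk^{-1}\sum_{\substack{S\subseteq[n]\\|S|=k}}\mathbb E_{x,\varepsilon}\|f(x+4m\varepsilon_S)-f(x)\|_{L_p(M)}^p\right)^{1/p}\le Km\left[\frac kn\sum_{j=1}^n\mathbb E_x\|f(x+e_j)-f(x)\|_{L_p(M)}^p+\left(\frac kn\right)^{p/2}\mathbb E_{x,\varepsilon}\|f(x+\varepsilon)-f(x)\|_{L_p(M)}^p\right]^{1/p}$$ for all $n\in\mathbb N$, $k\in[n]$, $m\in\mathbb N$ with $m\ge\sqrt{n/k}$, all measure spaces $(M,\nu)$, both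 scalar fields, and all $f:\mathbb Z_{8m}^n\to L_p(M,\nu)$, then $K\ge c\,p/\log p$.
   Context: $[n]=\{1,\dots,n\}$; $\mathbb Z_{8m}=\mathbb Z/(8m\mathbb Z)$; $e_1,\dots,e_n$ are the coordinate vectors of $\mathbb Z_{8m}^n$. For $\varepsilon\in\{-1,1\}^n$ and $S\subseteq[n]$, $\varepsilon_S=\sum_{j\in S}\varepsilon_je_j\in\mathbb Z_{8m}^n$, and $x+\varepsilon$ means $x+\varepsilon_{[n]}$; all additions are in $\mathbb Z_{8m}^n$. $\mathbb E_x$ is the average over $x$ uniform in $\mathbb Z_{8m}^n$, and $\mathbb E_{x,\varepsilon}$ is the average over independent uniform $x\in\mathbb Z_{8m}^n$ and $\varepsilon\in\{-1,1\}^n$. Logarithms are natural. "Universal constant" means an absolute constant independent of all parameters. *)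

theory Defs
  imports "HOL-Analysis.Analysis" "HOL-Algebra.Product_Groups"
begin

definition avg :: "'i set \<Rightarrow> ('i \<Rightarrow> real) \<Rightarrow> real"
  where "avg A g = (\<Sum>a\<in>A. g a) / real (card A)"

text \<open>Elements of the Lebesgue space over \<open>M\<close> are represented by functions rather than by
  almost-everywhere classes.\<close>

definition Lp_space :: "real \<Rightarrow> 'a measure \<Rightarrow> ('a \<Rightarrow> 'b::real_normed_vector) set"
  where "Lp_space p M =
    {g \<in> borel_measurable M. integrable M (\<lambda>\<omega>. norm (g \<omega>) powr p)}"

definition Lp_norm :: "real \<Rightarrow> 'a measure \<Rightarrow> ('a \<Rightarrow> 'b::real_normed_vector) \<Rightarrow> real"
  where "Lp_norm p M g = (\<integral>\<omega>. norm (g \<omega>) powr p \<partial>M) powr (1 / p)"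

text \<open>The group of \<open>n\<close>-tuples, indexed by \<open>{1..n}\<close>, of integers modulo \<open>8 * m\<close>
  (additive, although its operation is written multiplicatively in the group record).\<close>

definition torus :: "nat \<Rightarrow> nat \<Rightarrow> (nat \<Rightarrow> int) monoid"
  where "torus n m = product_group {1..n} (\<lambda>_. integer_mod_group (8 * m))"

definition torus_vec :: "nat \<Rightarrow> nat \<Rightarrow> (nat \<Rightarrow> int) \<Rightarrow> nat \<Rightarrow> int"
  where "torus_vec n m v = (\<lambda>j\<in>{1..n}. v j mod int (8 * m))"

definition unit_vec :: "nat \<Rightarrow> nat \<Rightarrow> nat \<Rightarrow> nat \<Rightarrow> int"
  where "unit_vec n m j = torus_vec n m (\<lambda>i. if i = j then 1 else 0)"

definition signs :: "nat \<Rightarrow> (nat \<Rightarrow> int) set"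
  where "signs n = {1..n} \<rightarrow>\<^sub>E {-1, 1}"

definition sign_vec :: "nat \<Rightarrow> nat \<Rightarrow> (nat \<Rightarrow> int) \<Rightarrow> nat set \<Rightarrow> nat \<Rightarrow> int"
  where "sign_vec n m \<epsilon> S = torus_vec n m (\<lambda>j. if j \<in> S then \<epsilon> j else 0)"

text \<open>In \<open>Xp_lhs\<close> the group power \<open>[^]\<close> is the multiple by the natural number \<open>4 * m\<close>.\<close>

definition Xp_lhs ::
  "real \<Rightarrow> nat \<Rightarrow> nat \<Rightarrow> nat \<Rightarrow> 'a measure \<Rightarrow> ((nat \<Rightarrow> int) \<Rightarrow> 'a \<Rightarrow> 'b::real_normed_vector) \<Rightarrow> real"
  where "Xp_lhs p n k m M f =
    (1 / real (n choose k) *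
      (\<Sum>S | S \<subseteq> {1..n} \<and> card S = k.
        avg (carrier (torus n m) \<times> signs n) (\<lambda>(x, \<epsilon>).
          Lp_norm p M (\<lambda>\<omega>.
            f (x \<otimes>\<^bsub>torus n m\<^esub> (sign_vec n m \<epsilon> S [^]\<^bsub>torus n m\<^esub> (4 * m))) \<omega> - f x \<omega>) powr p)))
    powr (1 / p)"

definition Xp_rhs ::
  "real \<Rightarrow> nat \<Rightarrow> nat \<Rightarrow> nat \<Rightarrow> 'a measure \<Rightarrow> ((nat \<Rightarrow> int) \<Rightarrow> 'a \<Rightarrow> 'b::real_normed_vector) \<Rightarrow> real"
  where "Xp_rhs p n k m M f =
    (real k / real n *
      (\<Sum>j=1..n. avg (carrier (torus n m)) (\<lambda>x.
        Lp_norm p M (\<lambda>\<omega>. f (x \<otimes>\<^bsub>torus n m\<^esub> unit_vec n m j) \<omega> - f x \<omega>) powr p))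
     + (real k / real n) powr (p / 2) *
      avg (carrier (torus n m) \<times> signs n) (\<lambda>(x, \<epsilon>).
        Lp_norm p M (\<lambda>\<omega>. f (x \<otimes>\<^bsub>torus n m\<^esub> sign_vec n m \<epsilon> {1..n}) \<omega> - f x \<omega>) powr p))
    powr (1 / p)"

text \<open>\<open>metric_Xp TYPE('a) p K\<close>: the inequality with factor \<open>K * m\<close> holds for all admissible
  \<open>n\<close>, \<open>k\<close>, \<open>m\<close>, all measures on points of type \<open>'a\<close>, both scalar fields and all \<open>f\<close>.\<close>

definition metric_Xp :: "'a itself \<Rightarrow> real \<Rightarrow> real \<Rightarrow> bool"
  where "metric_Xp _ p K \<longleftrightarrow>
    (\<forall>(n::nat) (k::nat) (m::nat) (M :: 'a measure).
      k \<in> {1..n} \<and> real m \<ge> sqrt (real n / real k) \<longrightarrow>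
        (\<forall>f :: (nat \<Rightarrow> int) \<Rightarrow> 'a \<Rightarrow> real.
          (\<forall>x\<in>carrier (torus n m). f x \<in> Lp_space p M) \<longrightarrow>
          Xp_lhs p n k m M f \<le> K * real m * Xp_rhs p n k m M f) \<and>
        (\<forall>f :: (nat \<Rightarrow> int) \<Rightarrow> 'a \<Rightarrow> complex.
          (\<forall>x\<in>carrier (torus n m). f x \<in> Lp_space p M) \<longrightarrow>
          Xp_lhs p n k m M f \<le> K * real m * Xp_rhs p n k m M f))"

text \<open>Types cannot be quantified inside a formula, so a constant asserted to exist for measures on
  a type variable \<open>'a\<close> could depend on \<open>'a\<close>. To express universal constants and the range
  ``all measure spaces'', one states the existential claims for measures on the fixed type
  \<open>real\<close> and adds that, for every type \<open>'a\<close>, each factor \<open>K\<close> valid for measures on \<open>real\<close>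
  is valid for measures on \<open>'a\<close>. Given the latter, validity over \<open>real\<close> coincides with
  validity over all measure spaces.\<close>

end

theory Submission
  imports Defs "HOL-Library.Function_Algebras"
begin

text \<open>The upper bound rests on one inequality on the discrete cube (\<open>cube_Xp\<close>).  For a
  mean-zero function \<open>h\<close> of \<open>n\<close> signs, average over all \<open>k\<close>-sets \<open>S\<close> the \<open>p\<close>-th moment of the
  conditional expectation of \<open>h\<close> given the signs in \<open>S\<close>.  Let \<open>2 * k \<le> n\<close> and produce \<open>S\<close> by
  drawing coordinates one after the other, uniformly among those not yet drawn, and revealing the
  sign of each.  The conditional expectations \<open>M\<close> of \<open>h\<close> given what has been revealed form a
  martingale whose differences are conditionally symmetric, because the sign of the last drawn
  coordinate only multiplies the difference by itself.  Two facts make the random order useful.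
  The conditional variance of a step is the average of the squared first-order Fourier
  coefficients of \<open>h\<close> in the unrevealed coordinates; by Bessel's inequality it is at most
  \<open>2 / n\<close> times the conditional expectation of \<open>h\<^sup>2\<close>, so by Jensen's inequality the
  conditional square function contributes \<open>(2 * k / n) powr (p / 2)\<close> times the \<open>p\<close>-th moment of
  \<open>h\<close>.  And a step in the direction \<open>j\<close> is an average of discrete derivatives of \<open>h\<close>, so the
  \<open>p\<close>-th powers of the steps contribute \<open>2 * k / n\<close> times the \<open>p\<close>-th moments of the derivatives.

  What turns this into a bound on \<open>M\<close> is the martingale form of Rosenthal's inequality with
  constant of order \<open>p / ln p\<close> (\<open>symmetric_rosenthal\<close>).  It follows by integrating a good-\<open>\<lambda>\<close>
  inequality, which comes from the supermartingale \<open>cosh (\<theta> * M) * exp (- g * A)\<close> with \<open>A\<close> the sum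
  of the conditional variances and jumps capped at a level \<open>r\<close>
  (\<open>maximal_exponential_bound\<close>).  The order \<open>p / ln p\<close> arises because with \<open>\<theta>\<close> of order \<open>p\<close>
  one can afford \<open>cosh (\<theta> * r)\<close> to be of order \<open>p\<close>, that is, \<open>r\<close> of order \<open>ln p / p\<close>.

  On the torus the cube inequality is applied to \<open>\<epsilon> \<mapsto> f (x + \<epsilon>) - f (x - \<epsilon>)\<close>, which is odd and
  so has mean zero.  Averaging over the signs outside \<open>S\<close> gives the increment, along a step
  twice the signs in \<open>S\<close>, of a local average of \<open>f\<close>; \<open>2 * m\<close> such increments lead from \<open>x\<close> to
  the point displaced by \<open>4 * m\<close> times those signs (\<open>telescope\<close>).  Replacing \<open>f\<close> by its local
  average at the two ends costs the diagonal term, which is affordable precisely because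
  \<open>m \<ge> sqrt (n / k)\<close>.  All quantities are \<open>p\<close>-th powers, so the inequality for scalar functions
  integrates to the one for functions with values in a Lebesgue space, and a point mass gives the
  converse; in this way constants transfer between measure spaces.

  For the lower bound take \<open>N\<close> close to \<open>p / ln p\<close>, \<open>k = N\<close> and \<open>n\<close> of order \<open>N * p\<^sup>2\<close>, and let
  \<open>f\<close> be the sum over the first \<open>N\<close> coordinates of the distance to \<open>4 * m\<close>.  The random set \<open>S\<close>
  equals \<open>{1..N}\<close> with probability at least \<open>exp (- 6 * p)\<close>, and with a further probability of
  at least \<open>exp (- 6 * p)\<close> the point \<open>x\<close> is so placed that the displacement by \<open>4 * m\<close> increases
  \<open>f\<close> by at least \<open>2 * m * N\<close>.  The \<open>p\<close>-th root turns these exponentially small probabilities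
  into constant factors.\<close>

section \<open>Averages and power inequalities\<close>

lemma avg_eq_sum: "avg A g = (\<Sum>a\<in>A. g a / real (card A))"
  by (simp add: avg_def sum_divide_distrib)

lemma avg_cong: "A = B \<Longrightarrow> (\<And>a. a \<in> B \<Longrightarrow> g a = h a) \<Longrightarrow> avg A g = avg B h"
  unfolding avg_def by (metis sum.cong)

lemma avg_mono: "(\<And>a. a \<in> A \<Longrightarrow> g a \<le> h a) \<Longrightarrow> avg A g \<le> avg A h"
  unfolding avg_def by (simp add: divide_right_mono sum_mono)

lemma avg_nonneg: "(\<And>a. a \<in> A \<Longrightarrow> 0 \<le> g a) \<Longrightarrow> 0 \<le> avg A g"
  unfolding avg_def by (simp add: sum_nonneg)

lemma avg_const: "finite A \<Longrightarrow> A \<noteq> {} \<Longrightarrow> avg A (\<lambda>_. c) = c"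
  unfolding avg_def by simp

lemma avg_le_const: "finite A \<Longrightarrow> A \<noteq> {} \<Longrightarrow> (\<And>a. a \<in> A \<Longrightarrow> g a \<le> c) \<Longrightarrow> avg A g \<le> c"
  using avg_mono[of A g "\<lambda>_. c"] by (simp add: avg_const)

lemma avg_add: "avg A (\<lambda>a. g a + h a) = avg A g + avg A h"
  unfolding avg_def by (simp add: sum.distrib add_divide_distrib)

lemma avg_diff: "avg A (\<lambda>a. g a - h a) = avg A g - avg A h"
  unfolding avg_def by (simp add: sum_subtractf diff_divide_distrib)

lemma avg_cmult: "avg A (\<lambda>a. c * g a) = c * avg A g"
  unfolding avg_def by (simp add: sum_distrib_left)

lemma avg_minus: "avg A (\<lambda>a. - g a) = - avg A g"
  unfolding avg_def by (simp add: sum_negf)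

lemma avg_sum: "avg A (\<lambda>a. \<Sum>i\<in>I. g i a) = (\<Sum>i\<in>I. avg A (g i))"
  unfolding avg_eq_sum by (subst sum.swap) (simp add: sum_divide_distrib)

lemma avg_swap: "avg A (\<lambda>a. avg B (g a)) = avg B (\<lambda>b. avg A (\<lambda>a. g a b))"
  unfolding avg_eq_sum sum_divide_distrib
  by (subst sum.swap) (simp add: mult.commute)

lemma avg_Times: "avg (A \<times> B) g = avg A (\<lambda>a. avg B (\<lambda>b. g (a, b)))"
  unfolding avg_def by (simp add: sum.cartesian_product card_cartesian_product
      sum_divide_distrib[symmetric] mult.commute)

lemma avg_reindex: "bij_betw t A A \<Longrightarrow> avg A (\<lambda>a. g (t a)) = avg A g"
  unfolding avg_def by (simp add: sum.reindex_bij_betw)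

text \<open>Inside the half line this is the sign of the second derivative; at the left end it says that
  \<open>t powr p \<le> t\<close> for \<open>t\<close> in the unit interval.\<close>

lemma convex_on_powr: "p \<ge> 1 \<Longrightarrow> convex_on {0..} (\<lambda>x::real. x powr p)"
proof (rule convex_on_linorderI)
  fix t x y :: real
  assume p: "1 \<le> p" and t: "0 < t" "t < 1" and x: "x \<in> {0..}" and y: "y \<in> {0..}" and xy: "x < y"
  show "((1 - t) *\<^sub>R x + t *\<^sub>R y) powr p \<le> (1 - t) * x powr p + t * y powr p"
  proof (cases "x = 0")
    case True
    have "t powr p \<le> t" using p t powr_mono'[of 1 p t] by simp
    then show ?thesis using True t xy p by (simp add: powr_mult mult_right_mono)
  next
    case False
    with x y xy t show ?thesis
      using convex_onD[OF powr_convex[OF p], of t x y] by simp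
  qed
qed auto

lemma powr_avg_le:
  assumes "finite A" "A \<noteq> {}" "p \<ge> 1"
  shows "\<bar>avg A g\<bar> powr p \<le> avg A (\<lambda>a. \<bar>g a\<bar> powr p)"
proof -
  have c: "card A > 0" using assms by (simp add: card_gt_0_iff)
  have "\<bar>avg A g\<bar> \<le> avg A (\<lambda>a. \<bar>g a\<bar>)"
    unfolding avg_def using c by (simp add: divide_right_mono)
  then have "\<bar>avg A g\<bar> powr p \<le> avg A (\<lambda>a. \<bar>g a\<bar>) powr p"
    using assms by (intro powr_mono2) auto
  also have "\<dots> = (\<lambda>x. x powr p) (\<Sum>a\<in>A. (1 / real (card A)) *\<^sub>R \<bar>g a\<bar>)"
    by (simp add: avg_eq_sum)
  also have "\<dots> \<le> (\<Sum>a\<in>A. (1 / real (card A)) * \<bar>g a\<bar> powr p)"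
    using assms c by (intro convex_on_sum[OF _ _ convex_on_powr]) auto
  also have "\<dots> = avg A (\<lambda>a. \<bar>g a\<bar> powr p)"
    by (simp add: avg_eq_sum)
  finally show ?thesis .
qed

lemma powr_sum_le:
  fixes a :: "'i \<Rightarrow> real"
  assumes "finite I" "p \<ge> 1" "\<And>i. i \<in> I \<Longrightarrow> 0 \<le> a i"
  shows "(\<Sum>i\<in>I. a i) powr p \<le> real (card I) powr (p - 1) * (\<Sum>i\<in>I. a i powr p)"
proof (cases "I = {}")
  case False
  with assms have c: "real (card I) > 0" by (simp add: card_gt_0_iff)
  have "(\<Sum>i\<in>I. a i) powr p = (real (card I) * \<bar>avg I a\<bar>) powr p"
    using c assms(3) by (simp add: avg_def sum_nonneg)
  also have "\<dots> = real (card I) powr p * \<bar>avg I a\<bar> powr p"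
    using c by (simp add: powr_mult)
  also have "\<dots> \<le> real (card I) powr p * avg I (\<lambda>i. \<bar>a i\<bar> powr p)"
    using powr_avg_le[OF assms(1) False assms(2)] by (intro mult_left_mono) auto
  also have "\<dots> = real (card I) powr (p - 1) * (\<Sum>i\<in>I. \<bar>a i\<bar> powr p)"
    using c by (simp add: avg_def powr_diff)
  finally show ?thesis using assms(3) by simp
qed simp

lemma powr_add_le:
  fixes a b :: real assumes "p \<ge> 1" "0 \<le> a" "0 \<le> b"
  shows "(a + b) powr p \<le> 2 powr (p - 1) * (a powr p + b powr p)"
  using powr_sum_le[of "{False, True}" p "\<lambda>i. if i then a else b"] assms by (simp add: add.commute)

section \<open>Expectation along random draws\<close>

text \<open>A list records the history of the draws, newest draw first, and \<open>nxt\<close> gives the equally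
  likely next draws after a history.  Any process is then simply a function on lists, and the
  running sums and maxima below need no extra state.\<close>

definition step :: "('a list \<Rightarrow> 'a set) \<Rightarrow> ('a list \<Rightarrow> real) \<Rightarrow> 'a list \<Rightarrow> real"
  where "step nxt F l = avg (nxt l) (\<lambda>a. F (a # l))"

primrec expect :: "('a list \<Rightarrow> 'a set) \<Rightarrow> nat \<Rightarrow> ('a list \<Rightarrow> real) \<Rightarrow> real"
  where
    "expect nxt 0 F = F []"
  | "expect nxt (Suc k) F = expect nxt k (step nxt F)"

text \<open>The lists \<open>drop i l\<close> are the nonempty stages through which the history \<open>l\<close> was built up.  For a
  summand of the form \<open>v (tl l)\<close> each term is known before the draw it belongs to, as is required
  of a sum of conditional variances.\<close>

definition path_sum :: "('a list \<Rightarrow> real) \<Rightarrow> 'a list \<Rightarrow> real"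
  where "path_sum w l = (\<Sum>i<length l. w (drop i l))"

primrec path_max :: "('a list \<Rightarrow> real) \<Rightarrow> 'a list \<Rightarrow> real"
  where
    "path_max w [] = 0"
  | "path_max w (a # l) = max (w (a # l)) (path_max w l)"

lemma path_sum_Nil [simp]: "path_sum w [] = 0"
  by (simp add: path_sum_def)

lemma path_sum_Cons [simp]: "path_sum w (a # l) = w (a # l) + path_sum w l"
  by (simp add: path_sum_def sum.lessThan_Suc_shift del: sum.lessThan_Suc)

lemma path_sum_nonneg: "(\<And>l. 0 \<le> w l) \<Longrightarrow> 0 \<le> path_sum w l"
  by (simp add: path_sum_def sum_nonneg)

lemma path_max_nonneg: "0 \<le> path_max w l"
  by (induction l) auto

lemma path_max_powr_le:
  assumes "\<And>l. 0 \<le> w l" "p > 0"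
  shows "path_max w l powr p \<le> path_sum (\<lambda>l. w l powr p) l"
proof (induction l)
  case (Cons a l)
  then show ?case
    using path_sum_nonneg[of "\<lambda>l. w l powr p" l] by (auto simp: max_def add_increasing)
qed auto

lemma path_sum_powr_le:
  assumes "\<And>l. 0 \<le> w l" "p \<ge> 1"
  shows "path_sum w l powr p \<le> real (length l) powr (p - 1) * path_sum (\<lambda>l. w l powr p) l"
  unfolding path_sum_def using powr_sum_le[of "{..<length l}" p] assms by simp

lemma expect_mono:
  "(\<And>l. length l = k \<Longrightarrow> F l \<le> G l) \<Longrightarrow> expect nxt k F \<le> expect nxt k G"
proof (induction k arbitrary: F G)
  case (Suc k)
  show ?case unfolding expect.simps
    by (rule Suc.IH) (auto simp: step_def intro!: avg_mono Suc.prems)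
qed simp

lemma expect_cong:
  "(\<And>l. length l = k \<Longrightarrow> F l = G l) \<Longrightarrow> expect nxt k F = expect nxt k G"
  by (intro antisym expect_mono) auto

lemma expect_nonneg: "(\<And>l. length l = k \<Longrightarrow> 0 \<le> F l) \<Longrightarrow> 0 \<le> expect nxt k F"
proof (induction k arbitrary: F)
  case (Suc k)
  show ?case unfolding expect.simps
    by (rule Suc.IH) (auto simp: step_def intro!: avg_nonneg Suc.prems)
qed simp

lemma expect_add: "expect nxt k (\<lambda>l. F l + G l) = expect nxt k F + expect nxt k G"
proof (induction k arbitrary: F G)
  case (Suc k)
  then show ?case by (simp add: step_def[abs_def] avg_add)
qed simp

lemma expect_cmult: "expect nxt k (\<lambda>l. c * F l) = c * expect nxt k F"
proof (induction k arbitrary: F)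
  case (Suc k)
  then show ?case by (simp add: step_def[abs_def] avg_cmult)
qed simp

text \<open>An expectation is a finite iterated average, so it commutes with the integral over a level;
  this is what allows tail estimates to be integrated into moment estimates.\<close>

lemma has_integral_expect:
  fixes F :: "real \<Rightarrow> 'a list \<Rightarrow> real"
  assumes "\<And>l. ((\<lambda>t. F t l) has_integral G l) S"
  shows "((\<lambda>t. expect nxt k (F t)) has_integral expect nxt k G) S"
  using assms
proof (induction k arbitrary: F G)
  case (Suc k)
  have "((\<lambda>t. step nxt (F t) l) has_integral step nxt G l) S" for l
  proof (cases "finite (nxt l)")
    case True
    then have "((\<lambda>t. (\<Sum>a\<in>nxt l. F t (a # l))) has_integral (\<Sum>a\<in>nxt l. G (a # l))) S"
      by (intro has_integral_sum Suc.prems)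
    then show ?thesis unfolding step_def avg_def by (rule has_integral_divide)
  qed (simp add: step_def avg_def)
  then show ?case by (simp add: Suc.IH)
qed simp

text \<open>Only histories shorter than \<open>K\<close> need a successor, since drawing without replacement ends.\<close>

locale draws =
  fixes nxt :: "'a list \<Rightarrow> 'a set" and K :: nat
  assumes nxt: "length l < K \<Longrightarrow> finite (nxt l) \<and> nxt l \<noteq> {}"
begin

lemma expect_le_of_super:
  assumes "k \<le> K" "\<And>l. length l < k \<Longrightarrow> step nxt X l \<le> X l"
  shows "expect nxt k X \<le> X []"
  using assms
proof (induction k)
  case (Suc k)
  have "expect nxt (Suc k) X \<le> expect nxt k X"
    unfolding expect.simps using Suc.prems by (intro expect_mono) auto
  with Suc show ?case by fastforce
qed simp

lemma expect_martingale:
  assumes "k \<le> K" "\<And>l. length l < k \<Longrightarrow> step nxt X l = X l"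
  shows "expect nxt k X = X []"
  using assms
proof (induction k)
  case (Suc k)
  have "expect nxt (Suc k) X = expect nxt k X"
    unfolding expect.simps using Suc.prems by (intro expect_cong) auto
  with Suc show ?case by fastforce
qed simp

lemma expect_const: "k \<le> K \<Longrightarrow> expect nxt k (\<lambda>_. c) = c"
  by (rule expect_martingale) (auto simp: step_def avg_const nxt)

lemma expect_path_sum:
  assumes "k \<le> K"
  shows "expect nxt k (path_sum w) = (\<Sum>i<k. expect nxt i (step nxt w))"
  using assms
proof (induction k)
  case (Suc k)
  have "expect nxt (Suc k) (path_sum w) = expect nxt k (\<lambda>l. step nxt w l + path_sum w l)"
    unfolding expect.simps using Suc.prems
    by (intro expect_cong) (auto simp: step_def avg_add avg_const nxt)
  with Suc show ?case by (simp add: expect_add)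
qed simp

end

section \<open>An exponential supermartingale\<close>

lemma sinh_mult_le:
  fixes s y :: real assumes "0 \<le> s" "s \<le> 1" "0 \<le> y"
  shows "sinh (s * y) \<le> s * sinh y"
proof -
  have "convex_on {0::real..} sinh"
    by (rule f''_ge0_imp_convex[where f' = cosh and f'' = sinh])
      (auto intro!: derivative_eq_intros)
  from convex_onD[OF this, of s 0 y] assms show ?thesis by simp
qed

lemma cosh_minus_one: "cosh x - 1 = 2 * sinh (x / 2) ^ 2" for x :: real
  using cosh_double_cosh[of "x / 2"] by (simp add: cosh_square_eq)

text \<open>The quotient \<open>(cosh (\<theta> * d) - 1) / d\<^sup>2\<close> increases with \<open>\<bar>d\<bar>\<close>.  This turns a bound on
  the jumps and on the conditional variance into a bound on an exponential moment.\<close>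

lemma cosh_le_quadratic:
  fixes \<theta> d r :: real assumes "0 \<le> \<theta>" "0 < r" "\<bar>d\<bar> \<le> r"
  shows "cosh (\<theta> * d) \<le> 1 + (cosh (\<theta> * r) - 1) / r\<^sup>2 * d\<^sup>2"
proof -
  have "sinh (\<bar>d\<bar> / r * (\<theta> * r / 2)) \<le> \<bar>d\<bar> / r * sinh (\<theta> * r / 2)"
    using assms by (intro sinh_mult_le) auto
  then have "sinh (\<theta> * \<bar>d\<bar> / 2) \<le> \<bar>d\<bar> / r * sinh (\<theta> * r / 2)"
    using assms by (simp add: field_simps)
  then have "(sinh (\<theta> * \<bar>d\<bar> / 2))\<^sup>2 \<le> (\<bar>d\<bar> / r * sinh (\<theta> * r / 2))\<^sup>2"
    using assms by (intro power_mono) auto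
  then have "2 * (sinh (\<theta> * \<bar>d\<bar> / 2))\<^sup>2 \<le> 2 * (\<bar>d\<bar> / r * sinh (\<theta> * r / 2))\<^sup>2"
    by simp
  also have "\<dots> = d\<^sup>2 / r\<^sup>2 * (2 * (sinh (\<theta> * r / 2))\<^sup>2)"
    by (simp add: power_mult_distrib power_divide)
  finally have "2 * (sinh (\<theta> * \<bar>d\<bar> / 2))\<^sup>2 \<le> d\<^sup>2 / r\<^sup>2 * (2 * (sinh (\<theta> * r / 2))\<^sup>2)" .
  then have "cosh (\<theta> * \<bar>d\<bar>) - 1 \<le> d\<^sup>2 / r\<^sup>2 * (cosh (\<theta> * r) - 1)"
    by (simp add: cosh_minus_one)
  moreover have "cosh (\<theta> * \<bar>d\<bar>) = cosh (\<theta> * d)" by (cases "d \<ge> 0") auto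
  moreover have "d\<^sup>2 / r\<^sup>2 * (cosh (\<theta> * r) - 1) = (cosh (\<theta> * r) - 1) / r\<^sup>2 * d\<^sup>2" by simp
  ultimately show ?thesis by linarith
qed

context draws
begin

text \<open>The factor on the right is the probability of passing the lower level \<open>u\<close>, not just \<open>1\<close>;
  without it the estimate could not be integrated over all levels.  It is gained by running the
  supermartingale \<open>cosh (\<theta> * M) * exp (- g * A)\<close> only between the first passage above \<open>u\<close> and
  the first passage above \<open>b\<close>.  At the start its value is at most \<open>cosh (\<theta> * (u + r))\<close>, because
  the level \<open>u\<close> is overshot by one jump of size at most \<open>r\<close>; on reaching \<open>b\<close> with \<open>A \<le> r\<^sup>2\<close>
  its value is at least \<open>cosh (\<theta> * b) * exp (- g * r\<^sup>2)\<close>.\<close>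

lemma maximal_exponential_bound:
  fixes M v :: "'a list \<Rightarrow> real" and \<theta> u b r :: real
  assumes M0: "M [] = 0"
    and sym: "\<And>l \<phi>. length l < K \<Longrightarrow> (\<And>x::real. \<phi> (- x) = - \<phi> x) \<Longrightarrow>
                 avg (nxt l) (\<lambda>a. \<phi> (M (a # l) - M l)) = (0::real)"
    and var: "\<And>l. length l < K \<Longrightarrow> avg (nxt l) (\<lambda>a. (M (a # l) - M l)\<^sup>2) \<le> v l"
    and v0: "\<And>l. 0 \<le> v l"
    and pos: "0 \<le> \<theta>" "0 \<le> u" "0 < r" "u + r \<le> b"
  defines "Ms \<equiv> path_max (\<lambda>l. \<bar>M l\<bar>)"
    and "D \<equiv> path_max (\<lambda>l. \<bar>M l - M (tl l)\<bar>)"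
    and "A \<equiv> path_sum (\<lambda>l. v (tl l))"
  shows "exp (1 - cosh (\<theta> * r)) * cosh (\<theta> * b) *
           expect nxt K (\<lambda>l. of_bool (b < Ms l \<and> D l \<le> r \<and> A l \<le> r\<^sup>2))
         \<le> cosh (\<theta> * (u + r)) * expect nxt K (\<lambda>l. of_bool (u < Ms l))"
proof -
  define g where "g = (cosh (\<theta> * r) - 1) / r\<^sup>2"
  have g0: "g \<ge> 0" using pos by (simp add: g_def cosh_real_ge_1)
  have gr: "g * r\<^sup>2 = cosh (\<theta> * r) - 1" using pos by (simp add: g_def)
  have A0: "A l \<ge> 0" for l unfolding A_def by (intro path_sum_nonneg v0)
  have MMs: "\<bar>M l\<bar> \<le> Ms l" for l
    unfolding Ms_def using M0 by (cases l) auto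
  define good where "good l \<longleftrightarrow> D l \<le> r \<and> A l \<le> r\<^sup>2" for l
  have ACons: "A (a # l) = v l + A l" for a l by (simp add: A_def)
  have good_mono: "good (a # l) \<Longrightarrow> good l" for a l
    using v0[of l] by (auto simp: good_def D_def ACons)
  have jump: "good (a # l) \<Longrightarrow> \<bar>M (a # l) - M l\<bar> \<le> r" for a l
    by (auto simp: good_def D_def)
  have MsCons: "Ms (a # l) = max \<bar>M (a # l)\<bar> (Ms l)" for a l by (simp add: Ms_def)
  have cosh_mono: "cosh (\<theta> * x) \<le> cosh (\<theta> * y)" if "\<bar>x\<bar> \<le> y" for x y
  proof -
    have "cosh (\<theta> * x) = cosh (\<theta> * \<bar>x\<bar>)" by (cases "x \<ge> 0") auto
    moreover have "\<theta> * \<bar>x\<bar> \<le> \<theta> * y" using that pos by (intro mult_left_mono)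
    then have "cosh (\<theta> * \<bar>x\<bar>) \<le> cosh (\<theta> * y)"
      using that pos by (subst cosh_real_nonneg_le_iff) auto
    ultimately show ?thesis by linarith
  qed
  define Z where "Z l = cosh (\<theta> * M l) * exp (- g * A l)" for l
  define c where "c = exp (- (g * r\<^sup>2)) * cosh (\<theta> * b)"
  define Y where "Y l = (if good l then if b < Ms l then c else if u < Ms l then Z l else 0 else 0)" for l
  \<comment> \<open>Between the two passages \<open>Y\<close> is the supermartingale; after the passage above \<open>b\<close> it is
    frozen at \<open>c\<close>, a lower bound for the value on reaching \<open>b\<close>; it vanishes once a jump or the
    variance is too large.  Before the passage above \<open>u\<close>, the second summand of \<open>X\<close> is the largest
    value at which \<open>Y\<close> can start.\<close>
  define X where "X l = Y l + cosh (\<theta> * (u + r)) * of_bool (Ms l \<le> u)" for l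
  have c0: "c \<ge> 0" by (simp add: c_def)
  have Z0: "Z l \<ge> 0" for l by (simp add: Z_def)
  have Y0: "Y l \<ge> 0" for l using c0 Z0 by (simp add: Y_def)
  \<comment> \<open>Three phases: before the passage above \<open>u\<close> only the overshoot has to be controlled, between
    the two passages the supermartingale does the work, and after the passage above \<open>b\<close> the process
    can only drop to \<open>0\<close>.\<close>
  have super: "step nxt X l \<le> X l" if l: "length l < K" for l
  proof -
    note fin = nxt[OF l]
    consider "Ms l \<le> u" | "u < Ms l" "Ms l \<le> b" | "b < Ms l" by linarith
    then show ?thesis
    proof cases
      case 1
      have "X (a # l) \<le> cosh (\<theta> * (u + r))" for a
      proof (cases "good (a # l) \<and> u < Ms (a # l)")
        case True
        then have "\<bar>M (a # l)\<bar> \<le> u + r"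
          using jump[of a l] MMs[of l] 1 by linarith
        moreover from this 1 pos have "Ms (a # l) \<le> b" by (simp add: MsCons)
        moreover have "Z (a # l) \<le> cosh (\<theta> * M (a # l))"
          using g0 A0[of "a # l"] by (simp add: Z_def mult_left_le)
        ultimately show ?thesis using True cosh_mono[of "M (a # l)" "u + r"]
          by (simp add: X_def Y_def)
      next
        case False
        then show ?thesis using pos by (auto simp: X_def Y_def)
      qed
      then have "step nxt X l \<le> cosh (\<theta> * (u + r))"
        unfolding step_def using fin by (intro avg_le_const) auto
      also have "\<dots> \<le> X l" using 1 Y0[of l] by (simp add: X_def)
      finally show ?thesis .
    next
      case 2
      have XY: "X (a # l) = Y (a # l)" for a using 2 by (simp add: X_def MsCons)
      have Xl: "X l = Y l" using 2 by (simp add: X_def)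
      show ?thesis
      proof (cases "good l")
        case False
        then have "X (a # l) = 0" for a using good_mono[of a l] by (auto simp: XY Y_def)
        then show ?thesis using Y0[of l] by (simp add: step_def avg_def Xl)
      next
        case True
        define \<rho> where "\<rho> x = (of_bool (\<bar>x\<bar> \<le> r) :: real)" for x :: real
        define d where "d a = M (a # l) - M l" for a
        define e where "e = exp (- g * (v l + A l))"
        have "X (a # l) \<le> e * (cosh (\<theta> * M l) * (cosh (\<theta> * d a) * \<rho> (d a)) +
                               sinh (\<theta> * M l) * (sinh (\<theta> * d a) * \<rho> (d a)))" for a
        proof (cases "good (a # l)")
          case good: True
          have "X (a # l) \<le> Z (a # l)"
          proof (cases "b < Ms (a # l)")
            case True
            with 2 have "b < \<bar>M (a # l)\<bar>" by (auto simp: MsCons)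
            then have "cosh (\<theta> * b) \<le> cosh (\<theta> * M (a # l))"
              using cosh_mono[of b "\<bar>M (a # l)\<bar>"] pos
              by (cases "M (a # l) \<ge> 0") auto
            moreover have "exp (- (g * r\<^sup>2)) \<le> exp (- g * A (a # l))"
              using good g0 by (simp add: good_def mult_left_mono)
            ultimately show ?thesis
              using True good by (auto simp: XY Y_def c_def Z_def mult.commute intro!: mult_mono)
          next
            case False
            then show ?thesis using good Z0 by (simp add: XY Y_def)
          qed
          also have "Z (a # l) = e * cosh (\<theta> * M l + \<theta> * d a)"
            by (simp add: Z_def e_def ACons d_def algebra_simps)
          finally show ?thesis
            using jump[OF good] by (simp add: cosh_add \<rho>_def d_def)
        next
          case False
          have "X (a # l) = 0" using False by (simp add: XY Y_def)
          also have "0 \<le> e * (cosh (\<theta> * M l + \<theta> * d a) * \<rho> (d a))"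
            by (simp add: e_def \<rho>_def)
          finally show ?thesis by (simp add: cosh_add algebra_simps)
        qed
        then have "step nxt X l \<le> avg (nxt l) (\<lambda>a. e * (cosh (\<theta> * M l) * (cosh (\<theta> * d a) * \<rho> (d a)) +
                               sinh (\<theta> * M l) * (sinh (\<theta> * d a) * \<rho> (d a))))"
          unfolding step_def by (intro avg_mono)
        also have "\<dots> = e * (cosh (\<theta> * M l) * avg (nxt l) (\<lambda>a. cosh (\<theta> * d a) * \<rho> (d a)) +
                            sinh (\<theta> * M l) * avg (nxt l) (\<lambda>a. sinh (\<theta> * d a) * \<rho> (d a)))"
          by (simp only: avg_cmult avg_add)
        \<comment> \<open>Symmetry removes the odd part, also under the truncation \<open>\<rho>\<close> of the jumps, which is
          even.\<close>
        also have "avg (nxt l) (\<lambda>a. sinh (\<theta> * d a) * \<rho> (d a)) = 0"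
          unfolding d_def by (rule sym[OF l, of "\<lambda>x. sinh (\<theta> * x) * \<rho> x"]) (simp add: \<rho>_def)
        also have "avg (nxt l) (\<lambda>a. cosh (\<theta> * d a) * \<rho> (d a)) \<le> avg (nxt l) (\<lambda>a. 1 + g * (d a)\<^sup>2)"
          using cosh_le_quadratic[OF pos(1,3)] g0
          by (intro avg_mono) (auto simp: \<rho>_def g_def[symmetric])
        also have "\<dots> = 1 + g * avg (nxt l) (\<lambda>a. (d a)\<^sup>2)"
          using fin by (simp add: avg_add avg_cmult avg_const)
        also have "\<dots> \<le> 1 + g * v l"
          using var[OF l] g0 by (simp add: d_def mult_left_mono)
        also have "\<dots> \<le> exp (g * v l)" by (rule exp_ge_add_one_self)
        finally have "step nxt X l \<le> e * (cosh (\<theta> * M l) * exp (g * v l))"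
          by (simp add: e_def)
        also have "\<dots> = Z l" by (simp add: e_def Z_def mult_exp_exp[symmetric] algebra_simps flip: exp_add)
        also have "\<dots> = X l" using 2 True by (simp add: Xl Y_def)
        finally show ?thesis .
      qed
    next
      case 3
      have "X (a # l) \<le> X l" for a
      proof -
        have "b < Ms (a # l)" using 3 by (simp add: MsCons)
        with 3 show ?thesis using good_mono[of a l] c0 pos by (auto simp: X_def Y_def)
      qed
      then show ?thesis unfolding step_def using fin by (intro avg_le_const) auto
    qed
  qed
  have "expect nxt K X \<le> X []"
    by (rule expect_le_of_super) (auto intro: super)
  also have "X [] = cosh (\<theta> * (u + r))"
    using pos by (simp add: X_def Y_def Ms_def)
  finally have 1: "expect nxt K X \<le> cosh (\<theta> * (u + r))" .
  have "c * expect nxt K (\<lambda>l. of_bool (b < Ms l \<and> D l \<le> r \<and> A l \<le> r\<^sup>2))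
        + cosh (\<theta> * (u + r)) * expect nxt K (\<lambda>l. of_bool (Ms l \<le> u))
        = expect nxt K (\<lambda>l. c * of_bool (b < Ms l \<and> D l \<le> r \<and> A l \<le> r\<^sup>2)
                         + cosh (\<theta> * (u + r)) * of_bool (Ms l \<le> u))"
    by (simp only: expect_add expect_cmult)
  also have "\<dots> \<le> expect nxt K X"
    using Z0 by (intro expect_mono) (auto simp: X_def Y_def good_def)
  also note 1
  also have "cosh (\<theta> * (u + r)) = cosh (\<theta> * (u + r)) *
      expect nxt K (\<lambda>l. of_bool (u < Ms l) + of_bool (Ms l \<le> u))"
    by (subst expect_cong[where G = "\<lambda>_. 1"]) (auto simp: expect_const)
  also have "\<dots> = cosh (\<theta> * (u + r)) * expect nxt K (\<lambda>l. of_bool (u < Ms l)) +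
      cosh (\<theta> * (u + r)) * expect nxt K (\<lambda>l. of_bool (Ms l \<le> u))"
    by (simp add: expect_add algebra_simps)
  finally show ?thesis by (simp add: c_def gr)
qed

end

section \<open>Rosenthal's inequality for conditionally symmetric martingales\<close>

text \<open>The layer-cake formula for a single number.\<close>

lemma has_integral_powr_layer:
  fixes a p :: real assumes "0 \<le> a" "1 \<le> p"
  shows "((\<lambda>t. p * t powr (p - 1) * of_bool (t < a)) has_integral a powr p) {0..}"
proof -
  have "((\<lambda>t. p * t powr (p - 1)) has_integral (a powr p - 0 powr p)) {0..a}"
  proof (rule fundamental_theorem_of_calculus_interior)
    show "continuous_on {0..a} (\<lambda>t. t powr p)"
      using assms by (intro continuous_on_powr' continuous_intros) auto
    show "((\<lambda>t. t powr p) has_vector_derivative p * t powr (p - 1)) (at t)" if "t \<in> {0<..<a}" for t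
      using that assms unfolding has_real_derivative_iff_has_vector_derivative[symmetric]
      by (auto intro!: derivative_eq_intros)
  qed (use assms in auto)
  then have "((\<lambda>t. if t \<in> {0..a} then p * t powr (p - 1) else 0) has_integral a powr p) {0..}"
    using assms by (subst has_integral_restrict) auto
  then show ?thesis
    by (rule has_integral_spike[of "{a}", rotated 2]) (auto simp: of_bool_def)
qed

context draws
begin

text \<open>The choice \<open>\<theta> = 4 * p / t\<close> and \<open>r = \<delta> * t\<close> makes \<open>\<theta> * r = ln p\<close>.  Then
  \<open>cosh (\<theta> * r) - 1\<close> is at most \<open>p\<close>, while passing from the level \<open>2 * t\<close> to \<open>3 * t\<close>
  gains \<open>exp (4 * p)\<close>.\<close>

lemma good_lambda:
  fixes M v :: "'a list \<Rightarrow> real" and p t \<delta> :: real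
  assumes M0: "M [] = 0"
    and sym: "\<And>l \<phi>. length l < K \<Longrightarrow> (\<And>x::real. \<phi> (- x) = - \<phi> x) \<Longrightarrow>
                 avg (nxt l) (\<lambda>a. \<phi> (M (a # l) - M l)) = (0::real)"
    and var: "\<And>l. length l < K \<Longrightarrow> avg (nxt l) (\<lambda>a. (M (a # l) - M l)\<^sup>2) \<le> v l"
    and v0: "\<And>l. 0 \<le> v l"
    and p: "2 \<le> p" and t: "0 < t"
  defines "Ms \<equiv> path_max (\<lambda>l. \<bar>M l\<bar>)"
    and "D \<equiv> path_max (\<lambda>l. \<bar>M l - M (tl l)\<bar>)"
    and "A \<equiv> path_sum (\<lambda>l. v (tl l))"
    and "\<delta> \<equiv> ln p / (4 * p)"
  shows "expect nxt K (\<lambda>l. of_bool (t < Ms l / 3))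
     \<le> 2 * exp (- 3 * p) * expect nxt K (\<lambda>l. of_bool (t < Ms l))
       + (expect nxt K (\<lambda>l. of_bool (t < D l / \<delta>)) + expect nxt K (\<lambda>l. of_bool (t < sqrt (A l) / \<delta>)))"
proof -
  have A0: "A l \<ge> 0" for l unfolding A_def by (intro path_sum_nonneg v0)
  have \<delta>: "0 < \<delta>" "\<delta> \<le> 1"
    using p ln_le_minus_one[of p] by (auto simp: \<delta>_def field_simps)
  define \<theta> where "\<theta> = 4 * p / t"
  define r where "r = \<delta> * t"
  have \<theta>r: "\<theta> * r = ln p" using p t by (simp add: \<theta>_def r_def \<delta>_def)
  have \<theta>t: "\<theta> * t = 4 * p" using t by (simp add: \<theta>_def)
  let ?B = "expect nxt K (\<lambda>l. of_bool (3 * t < Ms l \<and> D l \<le> r \<and> A l \<le> r\<^sup>2))"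
  let ?U = "expect nxt K (\<lambda>l. of_bool (t < Ms l))"
  have r1: "r \<le> t" using \<delta> t by (simp add: r_def mult_left_le_one_le)
  have B0: "?B \<ge> 0" and U0: "?U \<ge> 0" by (auto intro: expect_nonneg)
  have main: "exp (1 - cosh (\<theta> * r)) * cosh (\<theta> * (3 * t)) * ?B \<le> cosh (\<theta> * (t + r)) * ?U"
    unfolding Ms_def D_def A_def
    by (rule maximal_exponential_bound[OF M0 sym var v0]) (use p t \<delta> r1 in \<open>auto simp: \<theta>_def r_def\<close>)
  have "inverse p \<le> 1" using p by (simp add: field_simps)
  then have "(p + inverse p) / 2 - 1 \<le> p" using p by argo
  then have "cosh (\<theta> * r) - 1 \<le> p"
    using p by (simp add: \<theta>r cosh_ln_real)
  then have e1: "exp (- p) \<le> exp (1 - cosh (\<theta> * r))" by simp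
  have \<theta>3t: "\<theta> * (3 * t) = 12 * p" using \<theta>t by simp
  have e2: "exp (12 * p) / 2 \<le> cosh (\<theta> * (3 * t))"
    unfolding \<theta>3t by (simp add: cosh_def)
  have c1: "cosh x \<le> exp x" if "x \<ge> 0" for x :: real
    using that order_trans[of "-x" 0 x] by (simp add: cosh_def)
  have "\<theta> * (t + r) \<le> 8 * p"
  proof -
    have "0 \<le> \<theta>" using p t by (simp add: \<theta>_def)
    then have "\<theta> * r \<le> \<theta> * t" using r1 by (rule mult_left_mono[rotated])
    then show ?thesis using \<theta>t unfolding distrib_left by linarith
  qed
  moreover have "0 \<le> \<theta> * (t + r)" using p t \<delta> by (simp add: \<theta>_def r_def)
  ultimately have e3: "cosh (\<theta> * (t + r)) \<le> exp (8 * p)"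
    using c1[of "\<theta> * (t + r)"] by (meson exp_le_cancel_iff order_trans)
  have "exp (- p) * (exp (12 * p) / 2) * ?B \<le> exp (1 - cosh (\<theta> * r)) * cosh (\<theta> * (3 * t)) * ?B"
    by (intro mult_mono e1 e2 B0) auto
  also note main
  also have "cosh (\<theta> * (t + r)) * ?U \<le> exp (8 * p) * ?U" by (intro mult_right_mono e3 U0)
  finally have "exp (- 8 * p) * (exp (- p) * (exp (12 * p) / 2) * ?B) \<le> exp (- 8 * p) * (exp (8 * p) * ?U)"
    by (intro mult_left_mono) auto
  then have "exp (3 * p) / 2 * ?B \<le> ?U"
    by (simp add: mult.assoc[symmetric] mult_exp_exp)
  then have "2 * exp (- 3 * p) * (exp (3 * p) / 2 * ?B) \<le> 2 * exp (- 3 * p) * ?U"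
    by (intro mult_left_mono) auto
  then have B: "?B \<le> 2 * exp (- 3 * p) * ?U"
    by (simp add: mult.assoc[symmetric] mult_exp_exp)
  have "expect nxt K (\<lambda>l. of_bool (t < Ms l / 3)) \<le>
     expect nxt K (\<lambda>l. of_bool (3 * t < Ms l \<and> D l \<le> r \<and> A l \<le> r\<^sup>2) +
      (of_bool (t < D l / \<delta>) + of_bool (t < sqrt (A l) / \<delta>)))"
  proof (rule expect_mono)
    fix l :: "'a list"
    have "D l \<le> r" if "\<not> t < D l / \<delta>" using that \<delta> by (simp add: r_def field_simps)
    moreover have "A l \<le> r\<^sup>2" if "\<not> t < sqrt (A l) / \<delta>"
    proof -
      have "sqrt (A l) \<le> r" using that \<delta> by (simp add: r_def field_simps)
      then show ?thesis using sqrt_le_D by blast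
    qed
    ultimately show "of_bool (t < Ms l / 3) \<le> of_bool (3 * t < Ms l \<and> D l \<le> r \<and> A l \<le> r\<^sup>2) +
      (of_bool (t < D l / \<delta>) + (of_bool (t < sqrt (A l) / \<delta>) :: real))"
      by (auto simp: of_bool_def)
  qed
  with B show ?thesis by (simp add: expect_add)
qed

text \<open>Integrating \<open>good_lambda\<close> over all levels loses \<open>3 powr p\<close> by the passage from \<open>t\<close> to
  \<open>3 * t\<close>, which the factor \<open>exp (- 3 * p)\<close> absorbs; so the moment of the maximal function on the
  right can be subtracted.\<close>

theorem symmetric_rosenthal:
  fixes M v :: "'a list \<Rightarrow> real" and p :: real
  assumes M0: "M [] = 0"
    and sym: "\<And>l \<phi>. length l < K \<Longrightarrow> (\<And>x::real. \<phi> (- x) = - \<phi> x) \<Longrightarrow>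
                 avg (nxt l) (\<lambda>a. \<phi> (M (a # l) - M l)) = (0::real)"
    and var: "\<And>l. length l < K \<Longrightarrow> avg (nxt l) (\<lambda>a. (M (a # l) - M l)\<^sup>2) \<le> v l"
    and v0: "\<And>l. 0 \<le> v l"
    and p: "2 \<le> p"
  shows "expect nxt K (\<lambda>l. \<bar>M l\<bar> powr p) \<le> 2 * (12 * (p / ln p)) powr p *
    (expect nxt K (\<lambda>l. path_sum (\<lambda>l. v (tl l)) l powr (p / 2))
     + expect nxt K (path_sum (\<lambda>l. \<bar>M l - M (tl l)\<bar> powr p)))"
proof -
  define Ms where "Ms = path_max (\<lambda>l. \<bar>M l\<bar>)"
  define D where "D = path_max (\<lambda>l. \<bar>M l - M (tl l)\<bar>)"
  define A where "A = path_sum (\<lambda>l. v (tl l))"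
  define \<delta> where "\<delta> = ln p / (4 * p)"
  have \<delta>: "0 < \<delta>" using p by (simp add: \<delta>_def)
  have A0: "A l \<ge> 0" for l unfolding A_def by (intro path_sum_nonneg v0)
  have Ms0: "Ms l \<ge> 0" and D0: "D l \<ge> 0" for l
    by (simp_all add: Ms_def D_def path_max_nonneg)
  let ?w = "\<lambda>t::real. p * t powr (p - 1)"
  have layer: "((\<lambda>t. ?w t * expect nxt K (\<lambda>l. of_bool (t < G l))) has_integral
      expect nxt K (\<lambda>l. G l powr p)) {0..}" if "\<And>l. 0 \<le> G l" for G :: "'a list \<Rightarrow> real"
    unfolding expect_cmult[symmetric]
    using that p by (intro has_integral_expect has_integral_powr_layer) auto
  have "expect nxt K (\<lambda>l. (Ms l / 3) powr p) \<le>
     2 * exp (- 3 * p) * expect nxt K (\<lambda>l. Ms l powr p)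
     + (expect nxt K (\<lambda>l. (D l / \<delta>) powr p) + expect nxt K (\<lambda>l. (sqrt (A l) / \<delta>) powr p))"
  proof (rule has_integral_le)
    show "((\<lambda>t. ?w t * expect nxt K (\<lambda>l. of_bool (t < Ms l / 3))) has_integral
        expect nxt K (\<lambda>l. (Ms l / 3) powr p)) {0..}"
      using Ms0 by (intro layer) auto
    show "((\<lambda>t. 2 * exp (- 3 * p) * (?w t * expect nxt K (\<lambda>l. of_bool (t < Ms l)))
         + (?w t * expect nxt K (\<lambda>l. of_bool (t < D l / \<delta>))
            + ?w t * expect nxt K (\<lambda>l. of_bool (t < sqrt (A l) / \<delta>)))) has_integral
       2 * exp (- 3 * p) * expect nxt K (\<lambda>l. Ms l powr p)
     + (expect nxt K (\<lambda>l. (D l / \<delta>) powr p) + expect nxt K (\<lambda>l. (sqrt (A l) / \<delta>) powr p))) {0..}"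
      using Ms0 D0 A0 \<delta> by (intro has_integral_add has_integral_mult_right layer) auto
    fix t :: real assume "t \<in> {0..}"
    then consider "t = 0" | "t > 0" by fastforce
    then show "?w t * expect nxt K (\<lambda>l. of_bool (t < Ms l / 3)) \<le>
        2 * exp (- 3 * p) * (?w t * expect nxt K (\<lambda>l. of_bool (t < Ms l)))
         + (?w t * expect nxt K (\<lambda>l. of_bool (t < D l / \<delta>))
            + ?w t * expect nxt K (\<lambda>l. of_bool (t < sqrt (A l) / \<delta>)))"
    proof cases
      case 2
      have "0 \<le> ?w t" using p by simp
      from mult_left_mono[OF good_lambda[OF M0 sym var v0 p 2] this] show ?thesis
        by (simp add: Ms_def D_def A_def \<delta>_def algebra_simps)
    qed simp
  qed
  moreover have "expect nxt K (\<lambda>l. (Ms l / 3) powr p) = expect nxt K (\<lambda>l. Ms l powr p) / 3 powr p"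
    using Ms0 expect_cmult[of nxt K "1 / 3 powr p" "\<lambda>l. Ms l powr p"] by (simp add: powr_divide)
  moreover have "expect nxt K (\<lambda>l. (D l / \<delta>) powr p) = expect nxt K (\<lambda>l. D l powr p) / \<delta> powr p"
    using D0 \<delta> expect_cmult[of nxt K "1 / \<delta> powr p" "\<lambda>l. D l powr p"] by (simp add: powr_divide)
  moreover have "(sqrt (A l) / \<delta>) powr p = 1 / \<delta> powr p * A l powr (p / 2)" for l
    using A0[of l] \<delta> by (simp add: powr_divide powr_half_sqrt[symmetric] powr_powr)
  then have "expect nxt K (\<lambda>l. (sqrt (A l) / \<delta>) powr p) = expect nxt K (\<lambda>l. A l powr (p / 2)) / \<delta> powr p"
    by (simp only: expect_cmult) simp
  ultimately have main: "expect nxt K (\<lambda>l. Ms l powr p) / 3 powr p \<le>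
     2 * exp (- 3 * p) * expect nxt K (\<lambda>l. Ms l powr p)
     + (expect nxt K (\<lambda>l. D l powr p) + expect nxt K (\<lambda>l. A l powr (p / 2))) / \<delta> powr p"
    (is "?m / _ \<le> _ + ?R / _")
    by (simp add: add_divide_distrib)
  have m0: "?m \<ge> 0" by (intro expect_nonneg) auto
  have "(3::real) \<le> exp 2" using exp_ge_add_one_self[of 2] by simp
  then have "3 powr p \<le> exp 2 powr p" using p by (intro powr_mono2) auto
  then have "4 * exp (- 3 * p) * 3 powr p \<le> 4 * exp (- 3 * p) * exp (2 * p)"
    by (intro mult_left_mono) (auto simp: powr_def mult.commute)
  also have "\<dots> = 4 * exp (- p)" by (simp add: mult_exp_exp)
  also have "\<dots> \<le> 1"
  proof -
    have "(2::real) ^ 2 \<le> exp 1 ^ 2" using exp_ge_add_one_self[of 1] by (intro power_mono) auto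
    also have "\<dots> = exp 2" by (simp add: exp_of_nat_mult[symmetric])
    also have "\<dots> \<le> exp p" using p by simp
    finally show ?thesis by (simp add: exp_minus field_simps)
  qed
  finally have "4 * exp (- 3 * p) * 3 powr p * ?m \<le> ?m"
    using m0 by (simp add: mult_left_le_one_le)
  moreover have "?m \<le> 2 * exp (- 3 * p) * 3 powr p * ?m + 3 powr p * ?R / \<delta> powr p"
    using mult_left_mono[OF main, of "3 powr p"] by (simp add: algebra_simps)
  ultimately have "?m \<le> 2 * (3 powr p * ?R / \<delta> powr p)" by linarith
  also have "\<dots> = 2 * (3 / \<delta>) powr p * ?R" using \<delta> by (simp add: powr_divide)
  also have "3 / \<delta> = 12 * (p / ln p)" by (simp add: \<delta>_def)
  finally have fin: "?m \<le> 2 * (12 * (p / ln p)) powr p * ?R" .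
  have "\<bar>M l\<bar> \<le> Ms l" for l unfolding Ms_def using M0 by (cases l) auto
  then have "expect nxt K (\<lambda>l. \<bar>M l\<bar> powr p) \<le> ?m"
    using p by (intro expect_mono powr_mono2) auto
  also note fin
  also have "?R \<le> expect nxt K (\<lambda>l. A l powr (p / 2))
      + expect nxt K (path_sum (\<lambda>l. \<bar>M l - M (tl l)\<bar> powr p))"
    using p unfolding D_def
    by (simp add: expect_mono path_max_powr_le)
  finally show ?thesis by (simp add: A_def mult_left_mono)
qed

end

section \<open>Revealing signs in random order\<close>

definition draw_nxt :: "nat \<Rightarrow> (nat \<times> int) list \<Rightarrow> (nat \<times> int) set"
  where "draw_nxt n l = ({1..n} - fst ` set l) \<times> {-1, 1}"

text \<open>The revealed signs overwrite a free sign vector, so that averaging over the latter conditions on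
  the former.\<close>

primrec impose :: "(nat \<times> int) list \<Rightarrow> (nat \<Rightarrow> int) \<Rightarrow> nat \<Rightarrow> int"
  where
    "impose [] \<epsilon> = \<epsilon>"
  | "impose (a # l) \<epsilon> = (impose l \<epsilon>)(fst a := snd a)"

text \<open>The conditional expectation of \<open>h\<close> given the revealed signs.\<close>

definition cond :: "nat \<Rightarrow> ((nat \<Rightarrow> int) \<Rightarrow> real) \<Rightarrow> (nat \<times> int) list \<Rightarrow> real"
  where "cond n h l = avg (signs n) (\<lambda>\<epsilon>. h (impose l \<epsilon>))"

text \<open>Averaging \<open>h (mix S \<epsilon> \<delta>)\<close> over \<open>\<delta>\<close> is the conditional expectation given the signs in \<open>S\<close>.\<close>

definition mix :: "nat set \<Rightarrow> (nat \<Rightarrow> int) \<Rightarrow> (nat \<Rightarrow> int) \<Rightarrow> nat \<Rightarrow> int"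
  where "mix S \<epsilon> \<delta> = (\<lambda>j. if j \<in> S then \<epsilon> j else \<delta> j)"

text \<open>The discrete derivative of \<open>h\<close>, up to the sign of the coordinate \<open>j\<close>.\<close>

definition flip_diff :: "nat \<Rightarrow> ((nat \<Rightarrow> int) \<Rightarrow> real) \<Rightarrow> (nat \<Rightarrow> int) \<Rightarrow> real"
  where "flip_diff j h \<epsilon> = (h (\<epsilon>(j := 1)) - h (\<epsilon>(j := - 1))) / 2"

lemma finite_signs [simp]: "finite (signs n)"
  by (simp add: signs_def finite_PiE)

lemma signs_nonempty [simp]: "signs n \<noteq> {}"
  by (auto simp: signs_def PiE_eq_empty_iff)

lemma signs_upd: "\<epsilon> \<in> signs n \<Longrightarrow> j \<in> {1..n} \<Longrightarrow> s \<in> {-1, 1} \<Longrightarrow> \<epsilon>(j := s) \<in> signs n"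
  by (auto simp: signs_def PiE_iff extensional_def)

lemma signs_cases: "\<epsilon> \<in> signs n \<Longrightarrow> j \<in> {1..n} \<Longrightarrow> \<epsilon> j = 1 \<or> \<epsilon> j = -1"
  by (auto simp: signs_def PiE_iff)

lemma bij_flip:
  assumes "j \<in> {1..n}"
  shows "bij_betw (\<lambda>\<epsilon>. \<epsilon>(j := - \<epsilon> j)) (signs n) (signs n)"
  using assms signs_cases
  by (intro bij_betwI[where g = "\<lambda>\<epsilon>. \<epsilon>(j := - \<epsilon> j)"]) (force intro: signs_upd)+

lemma avg_signs_split:
  assumes "j \<in> {1..n}"
  shows "avg (signs n) G = (avg (signs n) (\<lambda>\<epsilon>. G (\<epsilon>(j := 1))) + avg (signs n) (\<lambda>\<epsilon>. G (\<epsilon>(j := -1)))) / 2"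
proof -
  have "2 * avg (signs n) G = avg (signs n) G + avg (signs n) (\<lambda>\<epsilon>. G (\<epsilon>(j := - \<epsilon> j)))"
    by (simp add: avg_reindex[OF bij_flip[OF assms]])
  also have "\<dots> = avg (signs n) (\<lambda>\<epsilon>. G \<epsilon> + G (\<epsilon>(j := - \<epsilon> j)))" by (simp add: avg_add)
  also have "\<dots> = avg (signs n) (\<lambda>\<epsilon>. G (\<epsilon>(j := 1)) + G (\<epsilon>(j := -1)))"
  proof (rule avg_cong[OF refl])
    fix \<epsilon> assume "\<epsilon> \<in> signs n"
    from signs_cases[OF this assms] show "G \<epsilon> + G (\<epsilon>(j := - \<epsilon> j)) = G (\<epsilon>(j := 1)) + G (\<epsilon>(j := -1))"
      by (metis add.commute fun_upd_triv minus_minus)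
  qed
  finally show ?thesis by (simp add: avg_add)
qed

lemma avg_signs_pair: "avg (J \<times> {-1, 1 :: int}) g = avg J (\<lambda>j. (g (j, 1) + g (j, -1)) / 2)"
  by (simp add: avg_Times) (simp add: avg_def add.commute)

lemma impose_upd: "j \<notin> fst ` set l \<Longrightarrow> impose l (\<epsilon>(j := s)) = (impose l \<epsilon>)(j := s)"
  by (induction l) (auto simp: fun_upd_twist)

lemma impose_eq_mix: "impose l \<delta> = mix (fst ` set l) (impose l \<epsilon>) \<delta>"
  by (induction l) (auto simp: mix_def fun_eq_iff)

lemma mix_signs: "\<epsilon> \<in> signs n \<Longrightarrow> \<delta> \<in> signs n \<Longrightarrow> mix S \<epsilon> \<delta> \<in> signs n"
  unfolding signs_def mix_def by (rule PiE_I) (metis PiE_mem, metis PiE_arb)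

text \<open>Swapping the coordinates in \<open>S\<close> between two independent sign vectors preserves their joint
  distribution.\<close>

lemma avg_mix: "avg (signs n) (\<lambda>\<epsilon>. avg (signs n) (\<lambda>\<delta>. G (mix S \<epsilon> \<delta>))) = avg (signs n) G"
proof -
  let ?t = "\<lambda>(\<epsilon>, \<delta>). (mix S \<epsilon> \<delta>, mix S \<delta> \<epsilon>)"
  have b: "bij_betw ?t (signs n \<times> signs n) (signs n \<times> signs n)"
    by (intro bij_betwI[where g = ?t]) (auto simp: mix_signs, auto simp: mix_def)
  have "avg (signs n) (\<lambda>\<epsilon>. avg (signs n) (\<lambda>\<delta>. G (mix S \<epsilon> \<delta>)))
      = avg (signs n \<times> signs n) (\<lambda>z. (\<lambda>z. G (fst z)) (?t z))"
    by (simp add: avg_Times)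
  also have "\<dots> = avg (signs n \<times> signs n) (\<lambda>z. G (fst z))"
    by (rule avg_reindex[OF b])
  also have "\<dots> = avg (signs n) G" by (simp add: avg_Times avg_const)
  finally show ?thesis .
qed

lemma card_draw: "length l < n \<Longrightarrow> n - length l \<le> card ({1..n} - fst ` set l)"
proof -
  have "card (fst ` set l) \<le> length l"
    by (metis card_image_le card_length finite_set le_trans)
  then show ?thesis using diff_card_le_card_Diff[of "fst ` set l" "{1..n}"] by simp
qed

lemma draws_nxt: "K \<le> n \<Longrightarrow> draws (draw_nxt n) K"
proof
  fix l :: "(nat \<times> int) list" assume "K \<le> n" "length l < K"
  then have "card ({1..n} - fst ` set l) > 0" using card_draw[of l n] by simp
  then have "{1..n} - fst ` set l \<noteq> {}" by (metis card.empty less_numeral_extra(3))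
  then show "finite (draw_nxt n l) \<and> draw_nxt n l \<noteq> {}" by (auto simp: draw_nxt_def)
qed

lemma cond_Cons:
  "j \<notin> fst ` set l \<Longrightarrow> cond n h ((j, s) # l) = avg (signs n) (\<lambda>\<epsilon>. h (impose l (\<epsilon>(j := s))))"
  by (simp add: cond_def impose_upd)

lemma cond_split:
  assumes "j \<in> {1..n} - fst ` set l"
  shows "(cond n h ((j, 1) # l) + cond n h ((j, -1) # l)) / 2 = cond n h l"
  using assms by (simp add: cond_Cons avg_signs_split[where j = j and n = n and G = "\<lambda>\<epsilon>. h (impose l \<epsilon>)"] cond_def[of n h l])

lemma expect_cond: "k \<le> n \<Longrightarrow> expect (draw_nxt n) k (cond n h) = avg (signs n) h"
proof -
  assume k: "k \<le> n"
  interpret draws "draw_nxt n" k using k by (rule draws_nxt)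
  have "expect (draw_nxt n) k (cond n h) = cond n h []"
  proof (rule expect_martingale)
    fix l :: "(nat \<times> int) list" assume l: "length l < k"
    have "step (draw_nxt n) (cond n h) l = avg ({1..n} - fst ` set l) (\<lambda>_. cond n h l)"
      unfolding step_def draw_nxt_def avg_signs_pair by (intro avg_cong refl cond_split)
    also have "\<dots> = cond n h l"
      using nxt[OF l] by (intro avg_const) (auto simp: draw_nxt_def)
    finally show "step (draw_nxt n) (cond n h) l = cond n h l" .
  qed simp
  then show ?thesis by (simp add: cond_def)
qed

lemma bessel_signs:
  assumes "J \<subseteq> {1..n}"
  shows "(\<Sum>j\<in>J. (avg (signs n) (\<lambda>\<epsilon>. g \<epsilon> * of_int (\<epsilon> j)))\<^sup>2) \<le> avg (signs n) (\<lambda>\<epsilon>. (g \<epsilon>)\<^sup>2)"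
proof -
  have fJ: "finite J" using assms finite_subset by blast
  define c where "c j = avg (signs n) (\<lambda>\<epsilon>. g \<epsilon> * of_int (\<epsilon> j))" for j
  have orth: "avg (signs n) (\<lambda>\<epsilon>. of_int (\<epsilon> i) * of_int (\<epsilon> j)) = (of_bool (i = j) :: real)"
    if "i \<in> J" "j \<in> J" for i j
  proof (cases "i = j")
    case True
    have "avg (signs n) (\<lambda>\<epsilon>. of_int (\<epsilon> i) * of_int (\<epsilon> j)) = avg (signs n) (\<lambda>_. 1 :: real)"
      using signs_cases[of _ n j] that assms True by (intro avg_cong) fastforce+
    then show ?thesis using True by (simp add: avg_const)
  next
    case False
    then show ?thesis
      using that assms by (subst avg_signs_split[of i]) (auto simp: avg_minus)
  qed
  have "0 \<le> avg (signs n) (\<lambda>\<epsilon>. (g \<epsilon> - (\<Sum>j\<in>J. c j * of_int (\<epsilon> j)))\<^sup>2)"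
    by (intro avg_nonneg) auto
  also have "\<dots> = avg (signs n) (\<lambda>\<epsilon>. (g \<epsilon>)\<^sup>2 - 2 * (\<Sum>j\<in>J. c j * (g \<epsilon> * of_int (\<epsilon> j)))
      + (\<Sum>i\<in>J. \<Sum>j\<in>J. c i * (c j * (of_int (\<epsilon> i) * of_int (\<epsilon> j)))))"
    by (intro avg_cong refl)
      (simp add: power2_diff power2_eq_square sum_product sum_distrib_left algebra_simps)
  also have "\<dots> = avg (signs n) (\<lambda>\<epsilon>. (g \<epsilon>)\<^sup>2) - 2 * (\<Sum>j\<in>J. c j * c j)
      + (\<Sum>i\<in>J. \<Sum>j\<in>J. c i * (c j * of_bool (i = j)))"
    by (simp add: avg_add avg_diff avg_cmult avg_sum c_def[symmetric] orth)
  also have "(\<Sum>i\<in>J. \<Sum>j\<in>J. c i * (c j * of_bool (i = j))) = (\<Sum>j\<in>J. c j * c j)"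
    using fJ by (intro sum.cong refl) (simp add: of_bool_def sum.delta' if_distrib cong: if_cong)
  finally show ?thesis by (simp add: c_def power2_eq_square)
qed

text \<open>The first equation shows that the martingale differences are conditionally symmetric, the
  second that their size is a first-order Fourier coefficient in the unrevealed signs.\<close>

lemma cond_increment:
  assumes j: "j \<in> {1..n} - fst ` set l" and s: "s \<in> {-1, 1}"
  shows "cond n h ((j, s) # l) - cond n h l
       = of_int s * avg (signs n) (\<lambda>\<epsilon>. flip_diff j h (impose l \<epsilon>))"
    and "avg (signs n) (\<lambda>\<epsilon>. flip_diff j h (impose l \<epsilon>))
       = avg (signs n) (\<lambda>\<epsilon>. h (impose l \<epsilon>) * of_int (\<epsilon> j))"
proof -
  have d: "avg (signs n) (\<lambda>\<epsilon>. flip_diff j h (impose l \<epsilon>)) = (cond n h ((j, 1) # l) - cond n h ((j, -1) # l)) / 2"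
    using avg_cmult[of "signs n" "1 / 2" "\<lambda>\<epsilon>. h ((impose l \<epsilon>)(j := 1)) - h ((impose l \<epsilon>)(j := - 1))"]
    by (simp add: flip_diff_def cond_def avg_diff)
  show "cond n h ((j, s) # l) - cond n h l
       = of_int s * avg (signs n) (\<lambda>\<epsilon>. flip_diff j h (impose l \<epsilon>))"
    using s cond_split[OF j, of h] unfolding d by auto
  show "avg (signs n) (\<lambda>\<epsilon>. flip_diff j h (impose l \<epsilon>))
       = avg (signs n) (\<lambda>\<epsilon>. h (impose l \<epsilon>) * of_int (\<epsilon> j))"
    using j by (subst avg_signs_split[of j n "\<lambda>\<epsilon>. h (impose l \<epsilon>) * of_int (\<epsilon> j)"])
      (auto simp: d cond_Cons avg_minus)
qed

text \<open>Double counting: a set of size \<open>Suc k\<close> arises by inserting any of its elements last.\<close>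

lemma sum_choose_insert:
  fixes G :: "nat set \<Rightarrow> real"
  shows "(\<Sum>S | S \<subseteq> {1..n} \<and> card S = k. \<Sum>j\<in>{1..n} - S. G (insert j S))
    = real (Suc k) * (\<Sum>S | S \<subseteq> {1..n} \<and> card S = Suc k. G S)"
proof -
  have fin: "finite {S. S \<subseteq> {1..n} \<and> card S = i}" for i
    by (rule finite_subset[of _ "Pow {1..n}"]) auto
  have fS: "finite S" if "S \<subseteq> {1..n}" for S using that finite_subset by blast
  have "(\<Sum>S | S \<subseteq> {1..n} \<and> card S = k. \<Sum>j\<in>{1..n} - S. G (insert j S))
     = (\<Sum>(S, j)\<in>(SIGMA S:{S. S \<subseteq> {1..n} \<and> card S = k}. {1..n} - S). G (insert j S))"
    using fin by (intro sum.Sigma) auto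
  also have "\<dots> = (\<Sum>(T, j)\<in>(SIGMA T:{S. S \<subseteq> {1..n} \<and> card S = Suc k}. T). G T)"
    by (rule sum.reindex_bij_witness[where i = "\<lambda>(T, j). (T - {j}, j)" and j = "\<lambda>(S, j). (insert j S, j)"])
      (auto simp: insert_absorb fS card_insert_if)
  also have "\<dots> = (\<Sum>T | T \<subseteq> {1..n} \<and> card T = Suc k. \<Sum>j\<in>T. G T)"
    using fin fS by (intro sum.Sigma[symmetric]) auto
  also have "\<dots> = (\<Sum>T | T \<subseteq> {1..n} \<and> card T = Suc k. real (Suc k) * G T)"
    by (intro sum.cong) auto
  finally show ?thesis by (simp add: sum_distrib_left)
qed

text \<open>After \<open>k\<close> draws the set of drawn coordinates is a uniform \<open>k\<close>-set and the revealed signs are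
  uniform.  The induction peels off the last draw; averaging over it gives a function with the same
  invariance, so \<open>\<Psi>\<close> must be arbitrary.\<close>

lemma expect_draw_eq_subset_avg:
  assumes "k \<le> n"
    and "\<And>S \<epsilon> \<epsilon>'. (\<And>j. j \<in> S \<Longrightarrow> \<epsilon> j = \<epsilon>' j) \<Longrightarrow> \<Psi> S \<epsilon> = \<Psi> S \<epsilon>'"
  shows "expect (draw_nxt n) k (\<lambda>l. \<Psi> (fst ` set l) (impose l \<epsilon>0))
    = (\<Sum>S | S \<subseteq> {1..n} \<and> card S = k. avg (signs n) (\<Psi> S)) / real (n choose k)"
  using assms
proof (induction k arbitrary: \<Psi>)
  case 0
  have "{S. S \<subseteq> {1..n} \<and> card S = 0} = {{}}"
    by (auto simp: card_eq_0_iff dest: finite_subset)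
  moreover have "avg (signs n) (\<Psi> {}) = avg (signs n) (\<lambda>_. \<Psi> {} \<epsilon>0)"
    by (intro avg_cong refl 0) auto
  ultimately show ?case by (simp add: avg_const)
next
  case (Suc k)
  define \<Phi> where "\<Phi> S \<epsilon> = avg ({1..n} - S)
      (\<lambda>j. (\<Psi> (insert j S) (\<epsilon>(j := 1)) + \<Psi> (insert j S) (\<epsilon>(j := -1))) / 2)" for S \<epsilon>
  have inv: "\<Phi> S \<epsilon> = \<Phi> S \<epsilon>'" if "\<And>j. j \<in> S \<Longrightarrow> \<epsilon> j = \<epsilon>' j" for S \<epsilon> \<epsilon>'
  proof -
    have "\<Psi> (insert j S) (\<epsilon>(j := s)) = \<Psi> (insert j S) (\<epsilon>'(j := s))" for j s
      by (rule Suc.prems(2)) (auto simp: that)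
    then show ?thesis by (simp add: \<Phi>_def)
  qed
  have "step (draw_nxt n) (\<lambda>l. \<Psi> (fst ` set l) (impose l \<epsilon>0)) = (\<lambda>l. \<Phi> (fst ` set l) (impose l \<epsilon>0))"
    by (rule ext) (simp add: step_def draw_nxt_def avg_signs_pair \<Phi>_def)
  then have "expect (draw_nxt n) (Suc k) (\<lambda>l. \<Psi> (fst ` set l) (impose l \<epsilon>0))
     = expect (draw_nxt n) k (\<lambda>l. \<Phi> (fst ` set l) (impose l \<epsilon>0))" by simp
  also have "\<dots> = (\<Sum>S | S \<subseteq> {1..n} \<and> card S = k. avg (signs n) (\<Phi> S)) / real (n choose k)"
    by (rule Suc.IH[OF Suc_leD[OF Suc.prems(1)] inv])
  also have "(\<Sum>S | S \<subseteq> {1..n} \<and> card S = k. avg (signs n) (\<Phi> S))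
    = (\<Sum>S | S \<subseteq> {1..n} \<and> card S = k. (\<Sum>j\<in>{1..n} - S. avg (signs n) (\<Psi> (insert j S))) / real (n - k))"
  proof (rule sum.cong[OF refl])
    fix S assume S: "S \<in> {S. S \<subseteq> {1..n} \<and> card S = k}"
    then have c: "card ({1..n} - S) = n - k" by (subst card_Diff_subset) (auto dest: finite_subset)
    have "avg (signs n) (\<Phi> S) = avg ({1..n} - S) (\<lambda>j. avg (signs n)
        (\<lambda>\<epsilon>. (\<Psi> (insert j S) (\<epsilon>(j := 1)) + \<Psi> (insert j S) (\<epsilon>(j := -1))) / 2))"
      unfolding \<Phi>_def by (rule avg_swap)
    also have "\<dots> = avg ({1..n} - S) (\<lambda>j. avg (signs n) (\<Psi> (insert j S)))"
    proof (rule avg_cong[OF refl])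
      fix j assume "j \<in> {1..n} - S"
      then have j: "j \<in> {1..n}" by simp
      show "avg (signs n) (\<lambda>\<epsilon>. (\<Psi> (insert j S) (\<epsilon>(j := 1)) + \<Psi> (insert j S) (\<epsilon>(j := -1))) / 2)
         = avg (signs n) (\<Psi> (insert j S))"
        unfolding avg_signs_split[OF j, of "\<Psi> (insert j S)"] avg_add[symmetric]
        using avg_cmult[of "signs n" "1 / 2"] by simp
    qed
    finally show "avg (signs n) (\<Phi> S) = (\<Sum>j\<in>{1..n} - S. avg (signs n) (\<Psi> (insert j S))) / real (n - k)"
      by (simp only: avg_def[of "{1..n} - S"] c)
  qed
  also have "\<dots> = (\<Sum>S | S \<subseteq> {1..n} \<and> card S = k. \<Sum>j\<in>{1..n} - S. avg (signs n) (\<Psi> (insert j S))) / real (n - k)"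
    by (simp add: sum_divide_distrib)
  also have "\<dots> = real (Suc k) / real (n - k) * (\<Sum>S | S \<subseteq> {1..n} \<and> card S = Suc k. avg (signs n) (\<Psi> S))"
    by (subst sum_choose_insert) simp
  finally have ex: "expect (draw_nxt n) (Suc k) (\<lambda>l. \<Psi> (fst ` set l) (impose l \<epsilon>0)) =
     real (Suc k) / (real (n - k) * real (n choose k)) * (\<Sum>S | S \<subseteq> {1..n} \<and> card S = Suc k. avg (signs n) (\<Psi> S))"
    by simp
  have "real (Suc k) / (real (n - k) * real (n choose k)) = 1 / real (n choose Suc k)"
  proof -
    have "Suc k * (n choose Suc k) = (n - k) * (n choose k)"
      by (simp only: binomial_absorb_comp binomial_absorption)
    then have "real (Suc k) * real (n choose Suc k) = real (n - k) * real (n choose k)"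
      by (metis of_nat_mult)
    moreover have "n choose Suc k > 0" using Suc.prems(1) by simp
    ultimately show ?thesis by (simp add: field_simps)
  qed
  then show ?case unfolding ex by simp
qed

section \<open>The inequality on the discrete cube\<close>

text \<open>For \<open>2 * k \<le> n\<close> every draw has at least \<open>n / 2\<close> coordinates to choose from, which replaces
  the average over the undrawn coordinates by \<open>2 / n\<close> times a sum over them.\<close>

lemma cube_Xp_small:
  fixes h :: "(nat \<Rightarrow> int) \<Rightarrow> real"
  assumes p: "2 \<le> p" and k: "2 * k \<le> n" "0 < k" and mean: "avg (signs n) h = 0"
  shows "(\<Sum>S | S \<subseteq> {1..n} \<and> card S = k.
            avg (signs n) (\<lambda>\<epsilon>. \<bar>avg (signs n) (\<lambda>\<delta>. h (mix S \<epsilon> \<delta>))\<bar> powr p)) / real (n choose k)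
    \<le> 2 * (12 * (p / ln p)) powr p *
      ((2 * real k / real n) powr (p / 2) * avg (signs n) (\<lambda>\<epsilon>. \<bar>h \<epsilon>\<bar> powr p)
       + 2 * real k / real n * (\<Sum>j=1..n. avg (signs n) (\<lambda>\<epsilon>. \<bar>flip_diff j h \<epsilon>\<bar> powr p)))"
proof -
  define M where "M = cond n h"
  define v where "v l = 2 / real n * cond n (\<lambda>\<epsilon>. (h \<epsilon>)\<^sup>2) l" for l
  have n: "0 < n" and kn: "k \<le> n" using k by auto
  interpret draws "draw_nxt n" k using kn by (rule draws_nxt)
  have half: "real n / 2 \<le> real (card ({1..n} - fst ` set l))" if "length l < k" for l :: "(nat \<times> int) list"
    using card_draw[of l n] that k by linarith
  have avg_small: "avg ({1..n} - fst ` set l) g \<le> 2 / real n * sum g ({1..n} - fst ` set l)"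
    if "length l < k" "\<And>j. 0 \<le> g j" for l :: "(nat \<times> int) list" and g
  proof -
    have "avg ({1..n} - fst ` set l) g \<le> sum g ({1..n} - fst ` set l) / (real n / 2)"
      unfolding avg_def using half[OF that(1)] n that(2)
      by (intro divide_left_mono) (auto simp: sum_nonneg)
    then show ?thesis by (simp add: field_simps)
  qed
  have M0: "M [] = 0" by (simp add: M_def cond_def mean)
  have inc: "M ((j, s) # l) - M l = of_int s * avg (signs n) (\<lambda>\<epsilon>. flip_diff j h (impose l \<epsilon>))"
    if "j \<in> {1..n} - fst ` set l" "s \<in> {-1, 1}" for j s l
    unfolding M_def by (rule cond_increment(1)[OF that])
  have sym: "avg (draw_nxt n l) (\<lambda>a. \<phi> (M (a # l) - M l)) = 0"
    if "\<And>x::real. \<phi> (- x) = - \<phi> x" for l and \<phi> :: "real \<Rightarrow> real"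
  proof -
    have "avg (draw_nxt n l) (\<lambda>a. \<phi> (M (a # l) - M l)) = avg ({1..n} - fst ` set l) (\<lambda>_. 0)"
      unfolding draw_nxt_def avg_signs_pair by (intro avg_cong refl) (simp add: inc that)
    then show ?thesis by (simp add: avg_def)
  qed
  have var: "avg (draw_nxt n l) (\<lambda>a. (M (a # l) - M l)\<^sup>2) \<le> v l" if l: "length l < k" for l
  proof -
    have "avg (draw_nxt n l) (\<lambda>a. (M (a # l) - M l)\<^sup>2)
      = avg ({1..n} - fst ` set l) (\<lambda>j. (avg (signs n) (\<lambda>\<epsilon>. h (impose l \<epsilon>) * of_int (\<epsilon> j)))\<^sup>2)"
      unfolding draw_nxt_def avg_signs_pair
      by (intro avg_cong refl) (simp add: inc cond_increment(2)[where s = 1])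
    also have "\<dots> \<le> 2 / real n * (\<Sum>j\<in>{1..n} - fst ` set l. (avg (signs n) (\<lambda>\<epsilon>. h (impose l \<epsilon>) * of_int (\<epsilon> j)))\<^sup>2)"
      by (intro avg_small l) auto
    also have "\<dots> \<le> v l"
      unfolding v_def cond_def by (intro mult_left_mono bessel_signs) auto
    finally show ?thesis .
  qed
  have v0: "0 \<le> v l" for l unfolding v_def cond_def by (intro mult_nonneg_nonneg avg_nonneg) auto
  have jumps: "expect (draw_nxt n) k (path_sum (\<lambda>l. \<bar>M l - M (tl l)\<bar> powr p))
     \<le> 2 * real k / real n * (\<Sum>j=1..n. avg (signs n) (\<lambda>\<epsilon>. \<bar>flip_diff j h \<epsilon>\<bar> powr p))"
  proof -
    have st: "step (draw_nxt n) (\<lambda>l. \<bar>M l - M (tl l)\<bar> powr p) l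
       \<le> 2 / real n * cond n (\<lambda>\<epsilon>. \<Sum>j=1..n. \<bar>flip_diff j h \<epsilon>\<bar> powr p) l" if l: "length l < k" for l
    proof -
      have "step (draw_nxt n) (\<lambda>l. \<bar>M l - M (tl l)\<bar> powr p) l
        \<le> avg ({1..n} - fst ` set l) (\<lambda>j. cond n (\<lambda>\<epsilon>. \<bar>flip_diff j h \<epsilon>\<bar> powr p) l)"
        unfolding step_def draw_nxt_def avg_signs_pair
      proof (rule avg_mono)
        fix j assume "j \<in> {1..n} - fst ` set l"
        with powr_avg_le[of "signs n" p "\<lambda>\<epsilon>. flip_diff j h (impose l \<epsilon>)"] p
        show "(\<bar>M ((j, 1) # l) - M (tl ((j, 1) # l))\<bar> powr p + \<bar>M ((j, - 1) # l) - M (tl ((j, - 1) # l))\<bar> powr p) / 2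
           \<le> cond n (\<lambda>\<epsilon>. \<bar>flip_diff j h \<epsilon>\<bar> powr p) l"
          by (simp add: inc cond_def)
      qed
      also have "\<dots> \<le> 2 / real n * (\<Sum>j\<in>{1..n} - fst ` set l. cond n (\<lambda>\<epsilon>. \<bar>flip_diff j h \<epsilon>\<bar> powr p) l)"
        unfolding cond_def by (intro avg_small l avg_nonneg) auto
      also have "\<dots> \<le> 2 / real n * (\<Sum>j=1..n. cond n (\<lambda>\<epsilon>. \<bar>flip_diff j h \<epsilon>\<bar> powr p) l)"
        unfolding cond_def by (intro mult_left_mono sum_mono2 avg_nonneg) auto
      finally show ?thesis by (simp add: cond_def avg_sum)
    qed
    have "expect (draw_nxt n) k (path_sum (\<lambda>l. \<bar>M l - M (tl l)\<bar> powr p))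
       \<le> (\<Sum>i<k. expect (draw_nxt n) i (\<lambda>l. 2 / real n * cond n (\<lambda>\<epsilon>. \<Sum>j=1..n. \<bar>flip_diff j h \<epsilon>\<bar> powr p) l))"
      unfolding expect_path_sum[OF order_refl] using st by (intro sum_mono expect_mono) auto
    also have "\<dots> = (\<Sum>i<k. 2 / real n * avg (signs n) (\<lambda>\<epsilon>. \<Sum>j=1..n. \<bar>flip_diff j h \<epsilon>\<bar> powr p))"
      using kn by (intro sum.cong) (simp_all only: expect_cmult expect_cond lessThan_iff)
    finally show ?thesis by (simp add: avg_sum mult_ac)
  qed
  have square: "expect (draw_nxt n) k (\<lambda>l. path_sum (\<lambda>l. v (tl l)) l powr (p / 2))
     \<le> (2 * real k / real n) powr (p / 2) * avg (signs n) (\<lambda>\<epsilon>. \<bar>h \<epsilon>\<bar> powr p)"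
  proof -
    have sq: "\<bar>x\<^sup>2\<bar> powr (p / 2) = \<bar>x\<bar> powr p" for x :: real
    proof -
      have "\<bar>x\<^sup>2\<bar> = \<bar>x\<bar> powr 2" by (cases "x = 0") simp_all
      then have "\<bar>x\<^sup>2\<bar> powr (p / 2) = (\<bar>x\<bar> powr 2) powr (p / 2)" by (rule arg_cong)
      then show ?thesis unfolding powr_powr by simp
    qed
    have vq: "v l powr (p / 2) \<le> (2 / real n) powr (p / 2) * cond n (\<lambda>\<epsilon>. \<bar>h \<epsilon>\<bar> powr p) l" for l
    proof -
      have "v l powr (p / 2) = (2 / real n) powr (p / 2) * \<bar>cond n (\<lambda>\<epsilon>. (h \<epsilon>)\<^sup>2) l\<bar> powr (p / 2)"
      proof -
        have "0 \<le> cond n (\<lambda>\<epsilon>. (h \<epsilon>)\<^sup>2) l" unfolding cond_def by (intro avg_nonneg) auto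
        then show ?thesis unfolding v_def by (subst powr_mult) auto
      qed
      also have "\<dots> \<le> (2 / real n) powr (p / 2) * cond n (\<lambda>\<epsilon>. \<bar>(h \<epsilon>)\<^sup>2\<bar> powr (p / 2)) l"
        unfolding cond_def using p by (intro mult_left_mono powr_avg_le) auto
      finally show ?thesis unfolding sq .
    qed
    have "expect (draw_nxt n) k (\<lambda>l. path_sum (\<lambda>l. v (tl l)) l powr (p / 2))
       \<le> expect (draw_nxt n) k (\<lambda>l. real k powr (p / 2 - 1) * path_sum (\<lambda>l. v (tl l) powr (p / 2)) l)"
      using p v0 by (intro expect_mono) (metis (no_types, lifting) path_sum_powr_le[of "\<lambda>l. v (tl l)" "p / 2"] divide_le_eq_1_pos le_divide_eq_1_pos zero_less_numeral)
    also have "\<dots> = real k powr (p / 2 - 1) * (\<Sum>i<k. expect (draw_nxt n) i (step (draw_nxt n) (\<lambda>l. v (tl l) powr (p / 2))))"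
      by (simp add: expect_cmult expect_path_sum)
    also have "\<dots> \<le> real k powr (p / 2 - 1) * (\<Sum>i<k. expect (draw_nxt n) i (\<lambda>l. (2 / real n) powr (p / 2) * cond n (\<lambda>\<epsilon>. \<bar>h \<epsilon>\<bar> powr p) l))"
    proof (intro mult_left_mono sum_mono expect_mono)
      fix i and l :: "(nat \<times> int) list" assume "i \<in> {..<k}" "length l = i"
      then have "step (draw_nxt n) (\<lambda>l. v (tl l) powr (p / 2)) l = v l powr (p / 2)"
        using nxt[of l] by (simp add: step_def avg_const)
      with vq[of l] show "step (draw_nxt n) (\<lambda>l. v (tl l) powr (p / 2)) l
         \<le> (2 / real n) powr (p / 2) * cond n (\<lambda>\<epsilon>. \<bar>h \<epsilon>\<bar> powr p) l" by simp
    qed auto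
    also have "\<dots> = real k powr (p / 2 - 1) * (\<Sum>i<k. (2 / real n) powr (p / 2) * avg (signs n) (\<lambda>\<epsilon>. \<bar>h \<epsilon>\<bar> powr p))"
      using kn by (intro arg_cong2[where f = "(*)"] sum.cong refl) (simp_all only: expect_cmult expect_cond lessThan_iff)
    also have "\<dots> = (2 * real k / real n) powr (p / 2) * avg (signs n) (\<lambda>\<epsilon>. \<bar>h \<epsilon>\<bar> powr p)"
      using k n by (simp add: powr_diff powr_mult powr_divide)
    finally show ?thesis .
  qed
  define \<Psi> where "\<Psi> S \<epsilon> = \<bar>avg (signs n) (\<lambda>\<delta>. h (mix S \<epsilon> \<delta>))\<bar> powr p" for S \<epsilon>
  have "(\<Sum>S | S \<subseteq> {1..n} \<and> card S = k. avg (signs n) (\<Psi> S)) / real (n choose k)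
     = expect (draw_nxt n) k (\<lambda>l. \<Psi> (fst ` set l) (impose l (\<lambda>_. 1)))"
    using kn by (intro expect_draw_eq_subset_avg[symmetric])
      (auto simp: \<Psi>_def mix_def cong: if_cong)
  also have "(\<lambda>l. \<Psi> (fst ` set l) (impose l (\<lambda>_. 1))) = (\<lambda>l. \<bar>M l\<bar> powr p)"
    by (rule ext) (simp add: \<Psi>_def M_def cond_def impose_eq_mix[symmetric])
  also have "expect (draw_nxt n) k (\<lambda>l. \<bar>M l\<bar> powr p) \<le> 2 * (12 * (p / ln p)) powr p *
    (expect (draw_nxt n) k (\<lambda>l. path_sum (\<lambda>l. v (tl l)) l powr (p / 2))
     + expect (draw_nxt n) k (path_sum (\<lambda>l. \<bar>M l - M (tl l)\<bar> powr p)))"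
    by (rule symmetric_rosenthal[OF M0 sym var v0 p])
  also have "\<dots> \<le> 2 * (12 * (p / ln p)) powr p *
      ((2 * real k / real n) powr (p / 2) * avg (signs n) (\<lambda>\<epsilon>. \<bar>h \<epsilon>\<bar> powr p)
       + 2 * real k / real n * (\<Sum>j=1..n. avg (signs n) (\<lambda>\<epsilon>. \<bar>flip_diff j h \<epsilon>\<bar> powr p)))"
    by (intro mult_left_mono add_mono square jumps) auto
  finally show ?thesis by (simp add: \<Psi>_def[abs_def])
qed

lemma avg_subset_const:
  "k \<le> n \<Longrightarrow> (\<Sum>S | S \<subseteq> {1..n} \<and> card S = k. c) / real (n choose k) = c"
  using n_subsets[of "{1..n}" k] by simp

lemma one_le_div_ln: "2 \<le> p \<Longrightarrow> 1 \<le> p / ln p" for p :: real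
  using ln_le_minus_one[of p] by (simp add: field_simps)

text \<open>For \<open>2 * k > n\<close> the factor \<open>2 * k / n\<close> exceeds \<open>1\<close> and it is enough that conditional
  expectations contract \<open>p\<close>-th moments.\<close>

theorem cube_Xp:
  fixes h :: "(nat \<Rightarrow> int) \<Rightarrow> real"
  assumes p: "2 \<le> p" and k: "k \<le> n" "0 < k" and mean: "avg (signs n) h = 0"
  shows "(\<Sum>S | S \<subseteq> {1..n} \<and> card S = k.
            avg (signs n) (\<lambda>\<epsilon>. \<bar>avg (signs n) (\<lambda>\<delta>. h (mix S \<epsilon> \<delta>))\<bar> powr p)) / real (n choose k)
    \<le> 2 * (12 * (p / ln p)) powr p *
      ((2 * real k / real n) powr (p / 2) * avg (signs n) (\<lambda>\<epsilon>. \<bar>h \<epsilon>\<bar> powr p)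
       + 2 * real k / real n * (\<Sum>j=1..n. avg (signs n) (\<lambda>\<epsilon>. \<bar>flip_diff j h \<epsilon>\<bar> powr p)))"
proof (cases "2 * k \<le> n")
  case True
  then show ?thesis by (intro cube_Xp_small p k mean)
next
  case False
  let ?H = "avg (signs n) (\<lambda>\<epsilon>. \<bar>h \<epsilon>\<bar> powr p)"
  let ?D = "\<Sum>j=1..n. avg (signs n) (\<lambda>\<epsilon>. \<bar>flip_diff j h \<epsilon>\<bar> powr p)"
  have H0: "0 \<le> ?H" and D0: "0 \<le> ?D" by (auto intro!: avg_nonneg sum_nonneg)
  have "avg (signs n) (\<lambda>\<epsilon>. \<bar>avg (signs n) (\<lambda>\<delta>. h (mix S \<epsilon> \<delta>))\<bar> powr p) \<le> ?H" for S
  proof -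
    have "avg (signs n) (\<lambda>\<epsilon>. \<bar>avg (signs n) (\<lambda>\<delta>. h (mix S \<epsilon> \<delta>))\<bar> powr p)
       \<le> avg (signs n) (\<lambda>\<epsilon>. avg (signs n) (\<lambda>\<delta>. \<bar>h (mix S \<epsilon> \<delta>)\<bar> powr p))"
      using p by (intro avg_mono powr_avg_le) auto
    also have "\<dots> = ?H" by (rule avg_mix)
    finally show ?thesis .
  qed
  then have "(\<Sum>S | S \<subseteq> {1..n} \<and> card S = k.
      avg (signs n) (\<lambda>\<epsilon>. \<bar>avg (signs n) (\<lambda>\<delta>. h (mix S \<epsilon> \<delta>))\<bar> powr p)) / real (n choose k)
    \<le> (\<Sum>S | S \<subseteq> {1..n} \<and> card S = k. ?H) / real (n choose k)"
    by (intro divide_right_mono sum_mono) auto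
  also have "\<dots> = ?H" by (rule avg_subset_const[OF k(1)])
  also have "\<dots> \<le> (2 * real k / real n) powr (p / 2) * ?H + 2 * real k / real n * ?D" (is "_ \<le> ?R")
  proof -
    have "1 \<le> (2 * real k / real n) powr (p / 2)"
      using False k p by (intro ge_one_powr_ge_zero) auto
    then have "?H \<le> (2 * real k / real n) powr (p / 2) * ?H"
      using H0 mult_right_mono by fastforce
    moreover have "0 \<le> 2 * real k / real n * ?D" using D0 by (intro mult_nonneg_nonneg) auto
    ultimately show ?thesis by linarith
  qed
  also have "\<dots> \<le> 2 * (12 * (p / ln p)) powr p * ?R"
  proof -
    have "1 \<le> (12 * (p / ln p)) powr p"
      using one_le_div_ln[OF p] p by (intro ge_one_powr_ge_zero) auto
    moreover have "0 \<le> ?R" using H0 D0 by (intro add_nonneg_nonneg mult_nonneg_nonneg) auto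
    ultimately show ?thesis using mult_right_mono[of 1 "2 * (12 * (p / ln p)) powr p" ?R] by simp
  qed
  finally show ?thesis .
qed

section \<open>From the cube to the torus\<close>

lemma carrier_torus: "0 < m \<Longrightarrow> carrier (torus n m) = {1..n} \<rightarrow>\<^sub>E {0..<int (8 * m)}"
  by (simp add: torus_def carrier_integer_mod_group)

lemma torus_vec_in_carrier: "0 < m \<Longrightarrow> torus_vec n m v \<in> carrier (torus n m)"
  by (auto simp: carrier_torus torus_vec_def)

lemma finite_carrier_torus: "0 < m \<Longrightarrow> finite (carrier (torus n m))"
  by (simp add: carrier_torus finite_PiE)

lemma carrier_torus_nonempty: "0 < m \<Longrightarrow> carrier (torus n m) \<noteq> {}"
  using torus_vec_in_carrier by blast

lemma torus_vec_cong: "(\<And>j. j \<in> {1..n} \<Longrightarrow> u j = v j) \<Longrightarrow> torus_vec n m u = torus_vec n m v"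
  by (auto simp: torus_vec_def restrict_def fun_eq_iff)

lemma torus_vec_id: "0 < m \<Longrightarrow> x \<in> carrier (torus n m) \<Longrightarrow> torus_vec n m x = x"
  by (auto simp: carrier_torus torus_vec_def PiE_iff extensional_def fun_eq_iff restrict_def)

lemma torus_vec_add [simp]:
  "torus_vec n m (torus_vec n m u + v) = torus_vec n m (u + v)"
  "torus_vec n m (torus_vec n m u - v) = torus_vec n m (u - v)"
  by (auto simp: torus_vec_def fun_eq_iff restrict_def mod_simps)

lemma torus_vec_idem [simp]: "torus_vec n m (torus_vec n m u) = torus_vec n m u"
  by (auto simp: torus_vec_def fun_eq_iff restrict_def)

lemma torus_mult: "x \<otimes>\<^bsub>torus n m\<^esub> torus_vec n m v = torus_vec n m (x + v)"
  by (auto simp: torus_def torus_vec_def fun_eq_iff restrict_def mod_simps)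

lemma torus_pow: "torus_vec n m v [^]\<^bsub>torus n m\<^esub> (N::nat) = torus_vec n m (\<lambda>j. int N * v j)"
proof (induction N)
  case 0
  then show ?case by (simp add: torus_def torus_vec_def restrict_def fun_eq_iff)
next
  case (Suc N)
  then show ?case
    by (simp add: torus_mult) (auto intro!: torus_vec_cong simp: algebra_simps)
qed

text \<open>Functions on the torus are handled as functions on all integer vectors that factor through
  reduction modulo \<open>8 * m\<close>; shifts may then be computed without reduction.\<close>

lemma avg_torus_shift:
  assumes m: "0 < m" and per: "\<And>x. \<Phi> (torus_vec n m x) = \<Phi> x"
  shows "avg (carrier (torus n m)) (\<lambda>x. \<Phi> (x + v)) = avg (carrier (torus n m)) \<Phi>"
proof -
  have "bij_betw (\<lambda>x. torus_vec n m (x + v)) (carrier (torus n m)) (carrier (torus n m))"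
    using m by (intro bij_betwI[where g = "\<lambda>x. torus_vec n m (x - v)"])
      (auto simp: torus_vec_in_carrier torus_vec_id)
  from avg_reindex[OF this, of \<Phi>] show ?thesis by (simp add: per)
qed

text \<open>The \<open>p\<close>-th powers of the two sides for scalar functions, in which no norm of a Lebesgue space
  occurs.\<close>

definition Xp_pow_lhs :: "real \<Rightarrow> nat \<Rightarrow> nat \<Rightarrow> nat \<Rightarrow> ((nat \<Rightarrow> int) \<Rightarrow> 'b::real_normed_vector) \<Rightarrow> real"
  where "Xp_pow_lhs p n k m f =
    (\<Sum>S | S \<subseteq> {1..n} \<and> card S = k. avg (carrier (torus n m)) (\<lambda>x. avg (signs n) (\<lambda>\<epsilon>.
      norm (f (torus_vec n m (x + (\<lambda>j. 4 * int m * mix S \<epsilon> 0 j))) - f x) powr p))) / real (n choose k)"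

definition Xp_pow_rhs :: "real \<Rightarrow> nat \<Rightarrow> nat \<Rightarrow> nat \<Rightarrow> ((nat \<Rightarrow> int) \<Rightarrow> 'b::real_normed_vector) \<Rightarrow> real"
  where "Xp_pow_rhs p n k m f =
    real k / real n * (\<Sum>j=1..n. avg (carrier (torus n m)) (\<lambda>x.
        norm (f (torus_vec n m (x + (\<lambda>i. of_bool (i = j)))) - f x) powr p))
     + (real k / real n) powr (p / 2) * avg (carrier (torus n m)) (\<lambda>x. avg (signs n) (\<lambda>\<epsilon>.
        norm (f (torus_vec n m (x + \<epsilon>)) - f x) powr p))"

lemma powr_add3_le:
  fixes a b c :: real
  assumes "p \<ge> 1" "0 \<le> a" "0 \<le> b" "0 \<le> c"
  shows "(a + b + c) powr p \<le> 3 powr (p - 1) * (a powr p + b powr p + c powr p)"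
  using powr_sum_le[of "{0, 1, 2 :: nat}" p "\<lambda>i. if i = 0 then a else if i = 1 then b else c"] assms
  by (simp add: add.assoc)

text \<open>The pointwise negative of a sign vector need not be a sign vector, as outside \<open>{1..n}\<close> it is
  the negative of the default value; hence the condition that \<open>G\<close> depends on the coordinates in
  \<open>{1..n}\<close> only.\<close>

lemma avg_signs_neg:
  assumes "\<And>\<delta> \<delta>'. (\<And>j. j \<in> {1..n} \<Longrightarrow> \<delta> j = \<delta>' j) \<Longrightarrow> G \<delta> = G \<delta>'"
  shows "avg (signs n) (\<lambda>\<delta>. G (- \<delta>)) = avg (signs n) G"
proof -
  have inv: "(\<lambda>j\<in>{1..n}. - \<delta> j) \<in> signs n" if "\<delta> \<in> signs n" for \<delta> :: "nat \<Rightarrow> int"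
    using signs_cases[OF that] by (auto simp: signs_def)
  have "bij_betw (\<lambda>\<delta>. \<lambda>j\<in>{1..n}. - \<delta> j) (signs n) (signs n)"
    by (intro bij_betwI[where g = "\<lambda>\<delta>. \<lambda>j\<in>{1..n}. - \<delta> j"])
      (auto simp: inv signs_def PiE_iff extensional_def fun_eq_iff restrict_def)
  from avg_reindex[OF this, of G] have "avg (signs n) (\<lambda>\<delta>. G (\<lambda>j\<in>{1..n}. - \<delta> j)) = avg (signs n) G" .
  moreover have "G (- \<delta>) = G (\<lambda>j\<in>{1..n}. - \<delta> j)" for \<delta>
    by (rule assms) auto
  ultimately show ?thesis by simp
qed

locale torus_function =
  fixes n m :: nat and p :: real and F :: "(nat \<Rightarrow> int) \<Rightarrow> real"
  assumes m: "0 < m" and p: "2 \<le> p"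
    and per [simp]: "F (torus_vec n m x) = F x"
begin

abbreviation "E\<^sub>x \<equiv> avg (carrier (torus n m))"
abbreviation "E\<^sub>s \<equiv> avg (signs n)"

lemma per_add [simp]: "F (torus_vec n m x + v) = F (x + v)" "F (torus_vec n m x - v) = F (x - v)"
  by (metis per torus_vec_add(1), metis per torus_vec_add(2))

lemma F_cong: "(\<And>j. j \<in> {1..n} \<Longrightarrow> u j = v j) \<Longrightarrow> F u = F v"
  by (metis per torus_vec_cong)

lemma shift: "(\<And>x. \<Phi> (torus_vec n m x) = \<Phi> x) \<Longrightarrow> E\<^sub>x (\<lambda>x. \<Phi> (x + v)) = E\<^sub>x \<Phi>"
  by (rule avg_torus_shift[OF m])

lemma two_sided_le:
  "E\<^sub>x (\<lambda>x. \<bar>F (x + v) - F (x - v)\<bar> powr p) \<le> 2 powr p * E\<^sub>x (\<lambda>x. \<bar>F (x + v) - F x\<bar> powr p)"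
proof -
  have "\<bar>F (x + v) - F (x - v)\<bar> powr p
      \<le> 2 powr (p - 1) * (\<bar>F (x + v) - F x\<bar> powr p + \<bar>F x - F (x - v)\<bar> powr p)" for x
    using p by (intro order_trans[OF powr_mono2 powr_add_le]) auto
  then have "E\<^sub>x (\<lambda>x. \<bar>F (x + v) - F (x - v)\<bar> powr p)
      \<le> E\<^sub>x (\<lambda>x. 2 powr (p - 1) * (\<bar>F (x + v) - F x\<bar> powr p + \<bar>F x - F (x - v)\<bar> powr p))"
    by (intro avg_mono)
  also have "\<dots> = 2 powr (p - 1) * (E\<^sub>x (\<lambda>x. \<bar>F (x + v) - F x\<bar> powr p) + E\<^sub>x (\<lambda>x. \<bar>F x - F (x - v)\<bar> powr p))"
    by (simp only: avg_cmult avg_add)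
  also have "E\<^sub>x (\<lambda>x. \<bar>F x - F (x - v)\<bar> powr p) = E\<^sub>x (\<lambda>x. \<bar>F (x + v) - F x\<bar> powr p)"
    using shift[of "\<lambda>x. \<bar>F x - F (x - v)\<bar> powr p" v] by simp
  finally show ?thesis by (simp add: powr_diff del: plus_fun_apply minus_apply)
qed

definition two_sided_diff where "two_sided_diff y \<epsilon> = F (y + \<epsilon>) - F (y - \<epsilon>)"

text \<open>The average of \<open>F\<close> over those vertices of the cube around \<open>y\<close> whose signs in \<open>S\<close> are those
  of \<open>\<epsilon>\<close>.\<close>

definition face_avg where "face_avg S \<epsilon> y = E\<^sub>s (\<lambda>\<delta>. F (y + mix S \<epsilon> \<delta>))"

lemma two_sided_diff_mean: "E\<^sub>s (two_sided_diff y) = 0"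
proof -
  have "E\<^sub>s (\<lambda>\<delta>. F (y + - \<delta>)) = E\<^sub>s (\<lambda>\<delta>. F (y + \<delta>))"
    by (rule avg_signs_neg) (rule F_cong, simp)
  then show ?thesis by (simp add: two_sided_diff_def[abs_def] avg_diff)
qed

text \<open>Negating the signs outside \<open>S\<close> moves the far endpoints of the two-sided increments onto a
  single translate of the face.\<close>

lemma face_avg_step: "face_avg S \<epsilon> y - face_avg S \<epsilon> (y - mix S \<epsilon> 0 - mix S \<epsilon> 0) = E\<^sub>s (\<lambda>\<delta>. two_sided_diff y (mix S \<epsilon> \<delta>))"
proof -
  have "E\<^sub>s (\<lambda>\<delta>. F (y - mix S \<epsilon> 0 - mix S \<epsilon> 0 + mix S \<epsilon> (- \<delta>)))
      = E\<^sub>s (\<lambda>\<delta>. F (y - mix S \<epsilon> 0 - mix S \<epsilon> 0 + mix S \<epsilon> \<delta>))"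
    by (rule avg_signs_neg) (rule F_cong, simp add: mix_def)
  moreover have eq: "y - mix S \<epsilon> 0 - mix S \<epsilon> 0 + mix S \<epsilon> (- \<delta>) = y - mix S \<epsilon> \<delta>" for \<delta>
    by (auto simp: mix_def fun_eq_iff)
  ultimately show ?thesis unfolding face_avg_def two_sided_diff_def avg_diff eq by simp
qed

lemma face_avg_per [simp]: "face_avg S \<epsilon> (torus_vec n m x) = face_avg S \<epsilon> x" "face_avg S \<epsilon> (torus_vec n m x + v) = face_avg S \<epsilon> (x + v)"
   "face_avg S \<epsilon> (torus_vec n m x - v) = face_avg S \<epsilon> (x - v)"
  unfolding face_avg_def by (metis per_add(1), metis per torus_vec_add(1) per_add(1), metis per torus_vec_add(2) per_add(1))

lemma two_sided_diff_per [simp]: "two_sided_diff (torus_vec n m x) \<epsilon> = two_sided_diff x \<epsilon>"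
  by (simp add: two_sided_diff_def)

definition "diag_energy = E\<^sub>x (\<lambda>x. E\<^sub>s (\<lambda>\<epsilon>. \<bar>F (x + \<epsilon>) - F x\<bar> powr p))"

lemma diag_energy_nonneg: "0 \<le> diag_energy"
  unfolding diag_energy_def by (intro avg_nonneg) auto

lemma two_sided_diff_le: "E\<^sub>x (\<lambda>x. E\<^sub>s (\<lambda>\<epsilon>. \<bar>two_sided_diff x \<epsilon>\<bar> powr p)) \<le> 2 powr p * diag_energy"
proof -
  have "E\<^sub>s (\<lambda>\<epsilon>. E\<^sub>x (\<lambda>x. \<bar>two_sided_diff x \<epsilon>\<bar> powr p))
     \<le> E\<^sub>s (\<lambda>\<epsilon>. 2 powr p * E\<^sub>x (\<lambda>x. \<bar>F (x + \<epsilon>) - F x\<bar> powr p))"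
    unfolding two_sided_diff_def by (intro avg_mono two_sided_le)
  also have "\<dots> = 2 powr p * diag_energy" unfolding diag_energy_def avg_cmult by (subst avg_swap) simp
  finally show ?thesis by (subst avg_swap)
qed

text \<open>Changing the sign \<open>j\<close> in \<open>F (x + \<epsilon>) - F (x - \<epsilon>)\<close> leaves two increments of length two in the
  direction \<open>j\<close>, at the points \<open>x + w\<close> and \<open>x - w\<close>, and the average over \<open>x\<close> does not see the
  translations by \<open>w\<close>.\<close>

lemma flip_diff_two_sided_diff_le:
  "E\<^sub>x (\<lambda>x. E\<^sub>s (\<lambda>\<epsilon>. \<bar>flip_diff j (two_sided_diff x) \<epsilon>\<bar> powr p))
    \<le> 2 powr p * E\<^sub>x (\<lambda>x. \<bar>F (x + (\<lambda>i. of_bool (i = j))) - F x\<bar> powr p)" (is "_ \<le> 2 powr p * ?E")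
proof -
  define e :: "nat \<Rightarrow> int" where "e = (\<lambda>i. of_bool (i = j))"
  define g where "g x = F (x + e) - F (x - e)" for x
  have gper [simp]: "g (torus_vec n m x) = g x" for x by (simp add: g_def)
  have *: "E\<^sub>x (\<lambda>x. \<bar>flip_diff j (two_sided_diff x) \<epsilon>\<bar> powr p) \<le> 2 powr p * ?E" for \<epsilon>
  proof -
    define w where "w = \<epsilon>(j := 0)"
    have up: "\<epsilon>(j := 1) = w + e" and dn: "\<epsilon>(j := -1) = w - e"
      by (auto simp: w_def e_def fun_eq_iff)
    have fd: "flip_diff j (two_sided_diff x) \<epsilon> = (g (x + w) + g (x + (- w))) / 2" for x
      by (simp add: flip_diff_def two_sided_diff_def up dn g_def algebra_simps)
    have "\<bar>flip_diff j (two_sided_diff x) \<epsilon>\<bar> powr p \<le> (\<bar>g (x + w)\<bar> powr p + \<bar>g (x + (- w))\<bar> powr p) / 2" for x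
    proof -
      have "\<bar>flip_diff j (two_sided_diff x) \<epsilon>\<bar> powr p \<le> ((\<bar>g (x + w)\<bar> + \<bar>g (x + (- w))\<bar>) / 2) powr p"
        unfolding fd using p by (intro powr_mono2) auto
      also have "\<dots> \<le> (\<bar>g (x + w)\<bar> powr p + \<bar>g (x + (- w))\<bar> powr p) / 2"
        using powr_add_le[of p "\<bar>g (x + w)\<bar>" "\<bar>g (x + (- w))\<bar>"] p
        by (simp add: powr_divide powr_diff field_simps)
      finally show ?thesis .
    qed
    then have "E\<^sub>x (\<lambda>x. \<bar>flip_diff j (two_sided_diff x) \<epsilon>\<bar> powr p)
      \<le> E\<^sub>x (\<lambda>x. 1 / 2 * (\<bar>g (x + w)\<bar> powr p + \<bar>g (x + (- w))\<bar> powr p))"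
      by (intro avg_mono) simp
    also have "\<dots> = 1 / 2 * (E\<^sub>x (\<lambda>x. \<bar>g (x + w)\<bar> powr p) + E\<^sub>x (\<lambda>x. \<bar>g (x + (- w))\<bar> powr p))"
      by (simp only: avg_cmult avg_add)
    also have "\<dots> = E\<^sub>x (\<lambda>x. \<bar>g x\<bar> powr p)"
      by (simp only: shift[of "\<lambda>x. \<bar>g x\<bar> powr p"] gper) simp
    also have "\<dots> \<le> 2 powr p * ?E"
      unfolding g_def e_def[symmetric] by (rule two_sided_le)
    finally show ?thesis .
  qed
  show ?thesis by (subst avg_swap) (rule avg_le_const[OF finite_signs signs_nonempty *])
qed

text \<open>The walk from \<open>x\<close> in \<open>2 * m\<close> steps of twice the signs in \<open>S\<close> is made with the face average
  instead of \<open>F\<close>.  Its starting value averages \<open>F\<close> at \<open>x\<close> plus a uniform sign vector, since the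
  signs in \<open>S\<close> belong to the average over \<open>\<epsilon>\<close>; so both ends cost one diagonal term.\<close>

lemma telescope:
  "E\<^sub>x (\<lambda>x. E\<^sub>s (\<lambda>\<epsilon>. \<bar>F (x + (\<lambda>j. 4 * int m * mix S \<epsilon> 0 j)) - F x\<bar> powr p))
   \<le> 3 powr (p - 1) * (2 * diag_energy + (2 * real m) powr p *
        E\<^sub>x (\<lambda>x. E\<^sub>s (\<lambda>\<epsilon>. \<bar>E\<^sub>s (\<lambda>\<delta>. two_sided_diff x (mix S \<epsilon> \<delta>))\<bar> powr p)))"
proof -
  define b where "b \<epsilon> y = \<bar>F y - face_avg S \<epsilon> y\<bar> powr p" for \<epsilon> y
  define c where "c \<epsilon> y = \<bar>E\<^sub>s (\<lambda>\<delta>. two_sided_diff y (mix S \<epsilon> \<delta>))\<bar> powr p" for \<epsilon> y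
  define V :: "(nat \<Rightarrow> int) \<Rightarrow> nat \<Rightarrow> nat \<Rightarrow> int" where "V \<epsilon> t = (\<lambda>j. 2 * int t * mix S \<epsilon> 0 j)" for \<epsilon> t
  have V0: "V \<epsilon> 0 = 0" for \<epsilon> by (simp add: V_def fun_eq_iff)
  have Vm: "V \<epsilon> (2 * m) = (\<lambda>j. 4 * int m * mix S \<epsilon> 0 j)" for \<epsilon> by (simp add: V_def)
  have VSuc: "x + V \<epsilon> t = x + V \<epsilon> (Suc t) - mix S \<epsilon> 0 - mix S \<epsilon> 0" for \<epsilon> t x
    by (simp add: V_def fun_eq_iff algebra_simps)
  have [simp]: "b \<epsilon> (torus_vec n m x) = b \<epsilon> x" "c \<epsilon> (torus_vec n m x) = c \<epsilon> x" for \<epsilon> x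
    by (simp_all add: b_def c_def)
  have pt: "\<bar>F (x + V \<epsilon> (2 * m)) - F x\<bar> powr p \<le> 3 powr (p - 1) *
       (b \<epsilon> (x + V \<epsilon> (2 * m)) + (2 * real m) powr (p - 1) * (\<Sum>t<2*m. c \<epsilon> (x + V \<epsilon> (Suc t))) + b \<epsilon> x)" for x \<epsilon>
  proof -
    let ?d = "\<lambda>t. E\<^sub>s (\<lambda>\<delta>. two_sided_diff (x + V \<epsilon> (Suc t)) (mix S \<epsilon> \<delta>))"
    have "(\<Sum>t<2*m. ?d t) = (\<Sum>t<2*m. face_avg S \<epsilon> (x + V \<epsilon> (Suc t)) - face_avg S \<epsilon> (x + V \<epsilon> t))"
      by (intro sum.cong refl) (simp only: face_avg_step[symmetric] VSuc[symmetric])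
    also have "\<dots> = face_avg S \<epsilon> (x + V \<epsilon> (2 * m)) - face_avg S \<epsilon> x"
      by (subst sum_lessThan_telescope) (simp add: V0)
    finally have "\<bar>F (x + V \<epsilon> (2 * m)) - F x\<bar> \<le> \<bar>F (x + V \<epsilon> (2 * m)) - face_avg S \<epsilon> (x + V \<epsilon> (2 * m))\<bar>
        + \<bar>\<Sum>t<2*m. ?d t\<bar> + \<bar>F x - face_avg S \<epsilon> x\<bar>" by linarith
    also have "\<dots> \<le> \<bar>F (x + V \<epsilon> (2 * m)) - face_avg S \<epsilon> (x + V \<epsilon> (2 * m))\<bar>
        + (\<Sum>t<2*m. \<bar>?d t\<bar>) + \<bar>F x - face_avg S \<epsilon> x\<bar>" by (intro add_mono order_refl sum_abs)
    finally have "\<bar>F (x + V \<epsilon> (2 * m)) - F x\<bar> powr p \<le> (\<bar>F (x + V \<epsilon> (2 * m)) - face_avg S \<epsilon> (x + V \<epsilon> (2 * m))\<bar>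
        + (\<Sum>t<2*m. \<bar>?d t\<bar>) + \<bar>F x - face_avg S \<epsilon> x\<bar>) powr p"
      using p by (intro powr_mono2) auto
    also have "\<dots> \<le> 3 powr (p - 1) * (b \<epsilon> (x + V \<epsilon> (2 * m)) + (\<Sum>t<2*m. \<bar>?d t\<bar>) powr p + b \<epsilon> x)"
      unfolding b_def using p by (intro powr_add3_le) (auto intro: sum_nonneg)
    also have "(\<Sum>t<2*m. \<bar>?d t\<bar>) powr p \<le> (2 * real m) powr (p - 1) * (\<Sum>t<2*m. c \<epsilon> (x + V \<epsilon> (Suc t)))"
      unfolding c_def using powr_sum_le[of "{..<2*m}" p "\<lambda>t. \<bar>?d t\<bar>"] p by simp
    finally show ?thesis by (simp del: plus_fun_apply)
  qed
  have "E\<^sub>x (\<lambda>x. \<bar>F (x + V \<epsilon> (2 * m)) - F x\<bar> powr p) \<le> 3 powr (p - 1) *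
        (2 * E\<^sub>x (b \<epsilon>) + (2 * real m) powr p * E\<^sub>x (c \<epsilon>))" for \<epsilon>
  proof -
    have "E\<^sub>x (\<lambda>x. \<bar>F (x + V \<epsilon> (2 * m)) - F x\<bar> powr p) \<le> E\<^sub>x (\<lambda>x. 3 powr (p - 1) *
       (b \<epsilon> (x + V \<epsilon> (2 * m)) + (2 * real m) powr (p - 1) * (\<Sum>t<2*m. c \<epsilon> (x + V \<epsilon> (Suc t))) + b \<epsilon> x))"
      by (intro avg_mono pt)
    also have "\<dots> = 3 powr (p - 1) * (E\<^sub>x (b \<epsilon>) + (2 * real m) powr (p - 1) * (\<Sum>t<2*m. E\<^sub>x (c \<epsilon>)) + E\<^sub>x (b \<epsilon>))"
      by (simp only: avg_cmult avg_add avg_sum shift[of "b \<epsilon>"] shift[of "c \<epsilon>"] \<open>\<And>x. b \<epsilon> (torus_vec n m x) = b \<epsilon> x\<close> \<open>\<And>x. c \<epsilon> (torus_vec n m x) = c \<epsilon> x\<close>)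
    also have "\<dots> = 3 powr (p - 1) * (2 * E\<^sub>x (b \<epsilon>) + (2 * real m) powr p * E\<^sub>x (c \<epsilon>))"
      using m by (simp add: powr_diff)
    finally show ?thesis .
  qed
  then have "E\<^sub>s (\<lambda>\<epsilon>. E\<^sub>x (\<lambda>x. \<bar>F (x + V \<epsilon> (2 * m)) - F x\<bar> powr p)) \<le>
      E\<^sub>s (\<lambda>\<epsilon>. 3 powr (p - 1) * (2 * E\<^sub>x (b \<epsilon>) + (2 * real m) powr p * E\<^sub>x (c \<epsilon>)))"
    by (intro avg_mono)
  also have "\<dots> = 3 powr (p - 1) * (2 * E\<^sub>s (\<lambda>\<epsilon>. E\<^sub>x (b \<epsilon>)) + (2 * real m) powr p * E\<^sub>s (\<lambda>\<epsilon>. E\<^sub>x (c \<epsilon>)))"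
    by (simp only: avg_cmult avg_add)
  also have "E\<^sub>s (\<lambda>\<epsilon>. E\<^sub>x (b \<epsilon>)) \<le> diag_energy"
  proof -
    have "b \<epsilon> x \<le> E\<^sub>s (\<lambda>\<delta>. \<bar>F (x + mix S \<epsilon> \<delta>) - F x\<bar> powr p)" for \<epsilon> x
    proof -
      have "F x - face_avg S \<epsilon> x = E\<^sub>s (\<lambda>\<delta>. F x - F (x + mix S \<epsilon> \<delta>))"
        by (simp add: face_avg_def avg_diff avg_const)
      then show ?thesis
        unfolding b_def using p powr_avg_le[of "signs n" p "\<lambda>\<delta>. F x - F (x + mix S \<epsilon> \<delta>)"]
        by (simp add: abs_minus_commute)
    qed
    then have "E\<^sub>x (\<lambda>x. E\<^sub>s (\<lambda>\<epsilon>. b \<epsilon> x)) \<le> E\<^sub>x (\<lambda>x. E\<^sub>s (\<lambda>\<epsilon>. E\<^sub>s (\<lambda>\<delta>. \<bar>F (x + mix S \<epsilon> \<delta>) - F x\<bar> powr p)))"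
      by (intro avg_mono)
    also have "\<dots> = diag_energy"
      unfolding diag_energy_def by (intro avg_cong refl avg_mix)
    finally show ?thesis by (subst avg_swap) simp
  qed
  finally show ?thesis
    unfolding Vm c_def by (subst (1 2) avg_swap) (simp add: mult_left_mono)
qed

text \<open>The hypothesis \<open>m \<ge> sqrt (n / k)\<close> enters through
  \<open>1 \<le> m powr p * (k / n) powr (p / 2)\<close>, which lets the diagonal terms at the two ends of the walk
  be absorbed.  In the constant, \<open>12\<close> comes from Rosenthal's inequality, a factor \<open>2\<close> from the
  number \<open>2 * m\<close> of steps, \<open>4\<close> from the two-sided increments together with \<open>2 * k / n\<close>, and the
  rest from the powers of sums of three terms and from numerical factors, bounded by
  \<open>2 powr p\<close>.\<close>

lemma real_torus_Xp:
  assumes k: "k \<in> {1..n}" and mk: "sqrt (real n / real k) \<le> real m"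
  shows "(\<Sum>S | S \<subseteq> {1..n} \<and> card S = k.
      E\<^sub>x (\<lambda>x. E\<^sub>s (\<lambda>\<epsilon>. \<bar>F (x + (\<lambda>j. 4 * int m * mix S \<epsilon> 0 j)) - F x\<bar> powr p))) / real (n choose k)
   \<le> (576 * (p / ln p) * real m) powr p *
     (real k / real n * (\<Sum>j=1..n. E\<^sub>x (\<lambda>x. \<bar>F (x + (\<lambda>i. of_bool (i = j))) - F x\<bar> powr p))
     + (real k / real n) powr (p / 2) * diag_energy)"
proof -
  define L where "L = p / ln p"
  define \<kappa> where "\<kappa> = real k / real n"
  define E where "E j = E\<^sub>x (\<lambda>x. \<bar>F (x + (\<lambda>i. of_bool (i = j))) - F x\<bar> powr p)" for j
  define R where "R = \<kappa> * (\<Sum>j=1..n. E j) + \<kappa> powr (p / 2) * diag_energy"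
  define c where "c S x = E\<^sub>s (\<lambda>\<epsilon>. \<bar>E\<^sub>s (\<lambda>\<delta>. two_sided_diff x (mix S \<epsilon> \<delta>))\<bar> powr p)" for S x
  have kn: "k \<le> n" "0 < k" using k by auto
  have L1: "1 \<le> L" using one_le_div_ln[OF p] by (simp add: L_def)
  have \<kappa>: "0 < \<kappa>" using kn by (simp add: \<kappa>_def)
  have E0: "0 \<le> E j" for j unfolding E_def by (intro avg_nonneg) auto
  have sE0: "0 \<le> (\<Sum>j=1..n. E j)" by (intro sum_nonneg E0)
  have R0: "0 \<le> R" using \<kappa> sE0 diag_energy_nonneg by (simp add: R_def)
  have cube: "E\<^sub>x (\<lambda>x. (\<Sum>S | S \<subseteq> {1..n} \<and> card S = k. c S x) / real (n choose k)) \<le> 2 * (12 * L) powr p * (4 powr p * R)"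
  proof -
    have "E\<^sub>x (\<lambda>x. (\<Sum>S | S \<subseteq> {1..n} \<and> card S = k. c S x) / real (n choose k))
      \<le> E\<^sub>x (\<lambda>x. 2 * (12 * L) powr p * ((2 * \<kappa>) powr (p / 2) * E\<^sub>s (\<lambda>\<epsilon>. \<bar>two_sided_diff x \<epsilon>\<bar> powr p)
       + 2 * \<kappa> * (\<Sum>j=1..n. E\<^sub>s (\<lambda>\<epsilon>. \<bar>flip_diff j (two_sided_diff x) \<epsilon>\<bar> powr p))))"
      using cube_Xp[OF p kn two_sided_diff_mean] by (intro avg_mono) (simp add: c_def L_def \<kappa>_def)
    also have "\<dots> = 2 * (12 * L) powr p * ((2 * \<kappa>) powr (p / 2) * E\<^sub>x (\<lambda>x. E\<^sub>s (\<lambda>\<epsilon>. \<bar>two_sided_diff x \<epsilon>\<bar> powr p))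
       + 2 * \<kappa> * (\<Sum>j=1..n. E\<^sub>x (\<lambda>x. E\<^sub>s (\<lambda>\<epsilon>. \<bar>flip_diff j (two_sided_diff x) \<epsilon>\<bar> powr p))))"
      by (simp only: avg_cmult avg_add avg_sum)
    also have "\<dots> \<le> 2 * (12 * L) powr p * ((2 * \<kappa>) powr (p / 2) * (2 powr p * diag_energy)
       + 2 * \<kappa> * (\<Sum>j=1..n. 2 powr p * E j))"
      unfolding E_def using \<kappa> by (intro mult_left_mono add_mono sum_mono two_sided_diff_le flip_diff_two_sided_diff_le) auto
    also have "\<dots> \<le> 2 * (12 * L) powr p * (4 powr p * R)"
    proof (intro mult_left_mono)
      have four: "(4::real) powr p = 2 powr p * 2 powr p" by (simp flip: powr_mult)
      have two: "(2::real) \<le> 2 powr p" using powr_mono[of 1 p 2] p by simp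
      have "(2 * \<kappa>) powr (p / 2) = 2 powr (p / 2) * \<kappa> powr (p / 2)" using \<kappa> by (simp add: powr_mult)
      also have "\<dots> \<le> 2 powr p * \<kappa> powr (p / 2)"
        using p by (intro mult_right_mono powr_mono) auto
      finally have "(2 * \<kappa>) powr (p / 2) * (2 powr p * diag_energy) \<le> 2 powr p * \<kappa> powr (p / 2) * (2 powr p * diag_energy)"
        using diag_energy_nonneg by (intro mult_right_mono) auto
      moreover have "2 * (\<kappa> * (2 powr p * (\<Sum>j=1..n. E j))) \<le> 2 powr p * (\<kappa> * (2 powr p * (\<Sum>j=1..n. E j)))"
        using two \<kappa> sE0 by (intro mult_right_mono) auto
      ultimately show "(2 * \<kappa>) powr (p / 2) * (2 powr p * diag_energy) + 2 * \<kappa> * (\<Sum>j=1..n. 2 powr p * E j) \<le> 4 powr p * R"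
        unfolding R_def four sum_distrib_left[symmetric] by (simp add: algebra_simps)
    qed auto
    finally show ?thesis .
  qed
  have cs: "E\<^sub>x (\<lambda>x. (\<Sum>S | S \<subseteq> {1..n} \<and> card S = k. c S x) / real (n choose k))
      = (\<Sum>S | S \<subseteq> {1..n} \<and> card S = k. E\<^sub>x (c S)) / real (n choose k)"
    using avg_cmult[of "carrier (torus n m)" "1 / real (n choose k)" "\<lambda>x. \<Sum>S | S \<subseteq> {1..n} \<and> card S = k. c S x"]
    by (simp add: avg_sum)
  have YR: "diag_energy \<le> real m powr p * R"
  proof -
    have "1 = sqrt \<kappa> * sqrt (real n / real k)" using kn by (simp add: \<kappa>_def real_sqrt_mult[symmetric])
    also have "\<dots> \<le> sqrt \<kappa> * real m" using mk \<kappa> by (intro mult_left_mono) auto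
    finally have "1 \<le> (sqrt \<kappa> * real m) powr p" using p by (intro ge_one_powr_ge_zero) auto
    also have "\<dots> = real m powr p * \<kappa> powr (p / 2)"
      using \<kappa> by (simp add: powr_mult powr_half_sqrt[symmetric] powr_powr)
    finally have "diag_energy \<le> real m powr p * \<kappa> powr (p / 2) * diag_energy"
      using diag_energy_nonneg mult_right_mono by fastforce
    also have "\<dots> \<le> real m powr p * R"
      unfolding R_def using \<kappa> sE0 by (simp add: mult.assoc mult_left_mono)
    finally show ?thesis .
  qed
  have "(\<Sum>S | S \<subseteq> {1..n} \<and> card S = k.
      E\<^sub>x (\<lambda>x. E\<^sub>s (\<lambda>\<epsilon>. \<bar>F (x + (\<lambda>j. 4 * int m * mix S \<epsilon> 0 j)) - F x\<bar> powr p))) / real (n choose k)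
    \<le> (\<Sum>S | S \<subseteq> {1..n} \<and> card S = k. 3 powr (p - 1) * (2 * diag_energy + (2 * real m) powr p * E\<^sub>x (c S))) / real (n choose k)"
    unfolding c_def by (intro divide_right_mono sum_mono telescope) auto
  also have "\<dots> = 3 powr (p - 1) * ((\<Sum>S | S \<subseteq> {1..n} \<and> card S = k. 2 * diag_energy) / real (n choose k)
       + (2 * real m) powr p * E\<^sub>x (\<lambda>x. (\<Sum>S | S \<subseteq> {1..n} \<and> card S = k. c S x) / real (n choose k)))"
    unfolding cs sum_distrib_left[symmetric] sum.distrib
    by (simp only: add_divide_distrib times_divide_eq_right[symmetric])
  also have "\<dots> \<le> 3 powr (p - 1) * (2 * (real m powr p * R) + (2 * real m) powr p * (2 * (12 * L) powr p * (4 powr p * R)))"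
    unfolding avg_subset_const[OF kn(1)] using YR by (intro mult_left_mono add_mono cube) auto
  also have "\<dots> \<le> 3 powr p * (4 * (96 * L * real m) powr p * R)"
  proof (rule mult_mono)
    have "(2 * real m) powr p * (12 * L) powr p * 4 powr p = (96 * L * real m) powr p"
      using L1 by (simp add: powr_mult[symmetric] mult_ac)
    moreover have "real m powr p \<le> (96 * L * real m) powr p"
      using L1 p mult_right_mono[of 1 "96 * L" "real m"] by (intro powr_mono2) auto
    then have "real m powr p * R \<le> (96 * L * real m) powr p * R" using R0 by (rule mult_right_mono)
    ultimately show "2 * (real m powr p * R) + (2 * real m) powr p * (2 * (12 * L) powr p * (4 powr p * R)) \<le> 4 * (96 * L * real m) powr p * R"
      by (simp add: algebra_simps)
  qed (use R0 in \<open>auto simp: powr_mono\<close>)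
  also have "\<dots> \<le> 3 powr p * (2 powr p * (96 * L * real m) powr p * R)"
    using powr_mono[of 2 p 2] p R0 by (intro mult_left_mono mult_right_mono) auto
  also have "\<dots> = (576 * L * real m) powr p * R"
    using L1 by (simp add: powr_mult[symmetric] mult_ac)
  finally show ?thesis by (simp add: R_def \<kappa>_def L_def E_def)
qed

end

section \<open>Scalar functions and Lebesgue spaces\<close>

definition scalar_Xp :: "'b::real_normed_vector itself \<Rightarrow> real \<Rightarrow> real \<Rightarrow> bool"
  where "scalar_Xp _ p K \<longleftrightarrow> (\<forall>(n::nat) k m (f :: (nat \<Rightarrow> int) \<Rightarrow> 'b).
    k \<in> {1..n} \<and> sqrt (real n / real k) \<le> real m \<longrightarrow>
      Xp_pow_lhs p n k m f \<le> (K * real m) powr p * Xp_pow_rhs p n k m f)"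

lemma admissible_pos: "k \<in> {1..n} \<Longrightarrow> sqrt (real n / real k) \<le> real m \<Longrightarrow> 0 < m"
  by (cases m) (auto simp: divide_le_0_iff)

lemma scalar_Xp_real:
  assumes p: "2 \<le> p"
  shows "scalar_Xp TYPE(real) p (576 * (p / ln p))"
  unfolding scalar_Xp_def
proof (intro allI impI, elim conjE)
  fix n k m :: nat and f :: "(nat \<Rightarrow> int) \<Rightarrow> real"
  assume k: "k \<in> {1..n}" and mk: "sqrt (real n / real k) \<le> real m"
  define F where "F x = f (torus_vec n m x)" for x
  have m: "0 < m" by (rule admissible_pos[OF k mk])
  interpret torus_function n m p F
    by standard (use m p in \<open>auto simp: F_def\<close>)
  have F: "f x = F x" if "x \<in> carrier (torus n m)" for x
    using that m by (simp add: F_def torus_vec_id)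
  have "Xp_pow_lhs p n k m f = (\<Sum>S | S \<subseteq> {1..n} \<and> card S = k.
      E\<^sub>x (\<lambda>x. E\<^sub>s (\<lambda>\<epsilon>. \<bar>F (x + (\<lambda>j. 4 * int m * mix S \<epsilon> 0 j)) - F x\<bar> powr p))) / real (n choose k)"
    unfolding Xp_pow_lhs_def real_norm_def F_def[symmetric]
    by (intro arg_cong2[where f = "(/)"] sum.cong avg_cong refl) (simp add: F)
  also have "\<dots> \<le> (576 * (p / ln p) * real m) powr p *
     (real k / real n * (\<Sum>j=1..n. E\<^sub>x (\<lambda>x. \<bar>F (x + (\<lambda>i. of_bool (i = j))) - F x\<bar> powr p))
     + (real k / real n) powr (p / 2) * diag_energy)"
    by (rule real_torus_Xp[OF k mk])
  also have "real k / real n * (\<Sum>j=1..n. E\<^sub>x (\<lambda>x. \<bar>F (x + (\<lambda>i. of_bool (i = j))) - F x\<bar> powr p))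
     + (real k / real n) powr (p / 2) * diag_energy = Xp_pow_rhs p n k m f"
    unfolding Xp_pow_rhs_def real_norm_def F_def[symmetric] diag_energy_def
    by (intro arg_cong2[where f = "(+)"] arg_cong2[where f = "(*)"] sum.cong avg_cong refl) (simp_all add: F)
  finally show "Xp_pow_lhs p n k m f \<le> (576 * (p / ln p) * real m) powr p * Xp_pow_rhs p n k m f" .
qed

lemma Xp_pow_lhs_mono:
  assumes "\<And>x y. norm (f x - f y) powr p \<le> c * norm (g x - g y) powr p + c * norm (g' x - g' y) powr p"
  shows "Xp_pow_lhs p n k m f \<le> c * Xp_pow_lhs p n k m g + c * Xp_pow_lhs p n k m g'"
proof -
  have "Xp_pow_lhs p n k m f \<le> (\<Sum>S | S \<subseteq> {1..n} \<and> card S = k. avg (carrier (torus n m)) (\<lambda>x. avg (signs n) (\<lambda>\<epsilon>.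
      c * norm (g (torus_vec n m (x + (\<lambda>j. 4 * int m * mix S \<epsilon> 0 j))) - g x) powr p +
      c * norm (g' (torus_vec n m (x + (\<lambda>j. 4 * int m * mix S \<epsilon> 0 j))) - g' x) powr p))) / real (n choose k)"
    unfolding Xp_pow_lhs_def by (intro divide_right_mono sum_mono avg_mono assms) auto
  also have "\<dots> = c * Xp_pow_lhs p n k m g + c * Xp_pow_lhs p n k m g'"
    unfolding Xp_pow_lhs_def avg_add avg_cmult sum.distrib sum_distrib_left[symmetric]
    by (simp only: add_divide_distrib times_divide_eq_right[symmetric])
  finally show ?thesis .
qed

lemma Xp_pow_rhs_mono:
  assumes "\<And>x y. norm (f x - f y) powr p \<le> norm (g x - g y) powr p"
  shows "Xp_pow_rhs p n k m f \<le> Xp_pow_rhs p n k m g"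
  unfolding Xp_pow_rhs_def
  by (intro add_mono mult_left_mono sum_mono avg_mono assms) auto

lemma Xp_pow_rhs_nonneg: "0 \<le> Xp_pow_rhs p n k m f"
  unfolding Xp_pow_rhs_def
  by (intro add_nonneg_nonneg mult_nonneg_nonneg sum_nonneg avg_nonneg) auto

lemma Xp_pow_lhs_nonneg: "0 \<le> Xp_pow_lhs p n k m f"
  unfolding Xp_pow_lhs_def
  by (intro divide_nonneg_nonneg sum_nonneg avg_nonneg) auto

lemma scalar_Xp_mono:
  fixes K K' :: real
  assumes "1 \<le> p" "0 \<le> K" "K \<le> K'" "scalar_Xp TYPE('b::real_normed_vector) p K"
  shows "scalar_Xp TYPE('b) p K'"
  unfolding scalar_Xp_def
proof (intro allI impI)
  fix n k m :: nat and f :: "(nat \<Rightarrow> int) \<Rightarrow> 'b"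
  assume adm: "k \<in> {1..n} \<and> sqrt (real n / real k) \<le> real m"
  have "Xp_pow_lhs p n k m f \<le> (K * real m) powr p * Xp_pow_rhs p n k m f"
    using assms(4) adm by (auto simp: scalar_Xp_def)
  also have "\<dots> \<le> (K' * real m) powr p * Xp_pow_rhs p n k m f"
    using assms by (intro mult_right_mono powr_mono2 Xp_pow_rhs_nonneg) auto
  finally show "Xp_pow_lhs p n k m f \<le> (K' * real m) powr p * Xp_pow_rhs p n k m f" .
qed

text \<open>The factor \<open>2\<close> is the cost of bounding the modulus by the sum of the moduli of the real and
  imaginary parts.\<close>

lemma scalar_Xp_complex:
  assumes p: "1 \<le> p" and K: "0 \<le> K" and real: "scalar_Xp TYPE(real) p K"
  shows "scalar_Xp TYPE(complex) p (2 * K)"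
  unfolding scalar_Xp_def
proof (intro allI impI)
  fix n k m :: nat and f :: "(nat \<Rightarrow> int) \<Rightarrow> complex"
  assume adm: "k \<in> {1..n} \<and> sqrt (real n / real k) \<le> real m"
  have "Xp_pow_lhs p n k m f \<le> 2 powr (p - 1) * Xp_pow_lhs p n k m (\<lambda>x. Re (f x))
      + 2 powr (p - 1) * Xp_pow_lhs p n k m (\<lambda>x. Im (f x))"
  proof (rule Xp_pow_lhs_mono)
    fix x y
    have "norm (f x - f y) powr p \<le> (\<bar>Re (f x - f y)\<bar> + \<bar>Im (f x - f y)\<bar>) powr p"
      using p by (intro powr_mono2 cmod_le) auto
    also have "\<dots> \<le> 2 powr (p - 1) * (\<bar>Re (f x - f y)\<bar> powr p + \<bar>Im (f x - f y)\<bar> powr p)"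
      using p by (intro powr_add_le) auto
    finally show "norm (f x - f y) powr p \<le> 2 powr (p - 1) * norm (Re (f x) - Re (f y)) powr p +
        2 powr (p - 1) * norm (Im (f x) - Im (f y)) powr p"
      by (simp add: distrib_left)
  qed
  also have "\<dots> \<le> 2 powr (p - 1) * ((K * real m) powr p * Xp_pow_rhs p n k m f)
      + 2 powr (p - 1) * ((K * real m) powr p * Xp_pow_rhs p n k m f)"
  proof (intro add_mono mult_left_mono)
    have re: "Xp_pow_rhs p n k m (\<lambda>x. Re (f x)) \<le> Xp_pow_rhs p n k m f"
      using p abs_Re_le_cmod by (intro Xp_pow_rhs_mono powr_mono2) (auto simp flip: minus_complex.sel)
    have im: "Xp_pow_rhs p n k m (\<lambda>x. Im (f x)) \<le> Xp_pow_rhs p n k m f"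
      using p abs_Im_le_cmod by (intro Xp_pow_rhs_mono powr_mono2) (auto simp flip: minus_complex.sel)
    note r = real[unfolded scalar_Xp_def, rule_format, OF adm]
    show "Xp_pow_lhs p n k m (\<lambda>x. Re (f x)) \<le> (K * real m) powr p * Xp_pow_rhs p n k m f"
      by (rule order_trans[OF r mult_left_mono[OF re]]) simp
    show "Xp_pow_lhs p n k m (\<lambda>x. Im (f x)) \<le> (K * real m) powr p * Xp_pow_rhs p n k m f"
      by (rule order_trans[OF r mult_left_mono[OF im]]) simp
  qed auto
  also have "\<dots> = (2 * K * real m) powr p * Xp_pow_rhs p n k m f"
    using K by (simp add: powr_mult powr_diff)
  finally show "Xp_pow_lhs p n k m f \<le> (2 * K * real m) powr p * Xp_pow_rhs p n k m f" .
qed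

lemma unit_vec_eq: "unit_vec n m j = torus_vec n m (\<lambda>i. of_bool (i = j))"
  by (simp add: unit_vec_def of_bool_def)

lemma sign_vec_eq: "sign_vec n m \<epsilon> S = torus_vec n m (mix S \<epsilon> 0)"
  by (simp add: sign_vec_def mix_def zero_fun_def)

lemma sign_vec_full: "sign_vec n m \<epsilon> {1..n} = torus_vec n m \<epsilon>"
  unfolding sign_vec_def by (rule torus_vec_cong) auto

lemma integrable_avg:
  "(\<And>a. a \<in> A \<Longrightarrow> integrable M (g a)) \<Longrightarrow> integrable M (\<lambda>\<omega>. avg A (\<lambda>a. g a \<omega>))"
  unfolding avg_def by (intro integrable_divide integrable_sum) auto

lemma integral_avg:
  assumes "\<And>a. a \<in> A \<Longrightarrow> integrable M (g a)"
  shows "(\<integral>\<omega>. avg A (\<lambda>a. g a \<omega>) \<partial>M) = avg A (\<lambda>a. \<integral>\<omega>. g a \<omega> \<partial>M)"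
  unfolding avg_def using assms by (simp add: Bochner_Integration.integral_sum)

lemma Lp_norm_powr:
  "p \<noteq> 0 \<Longrightarrow> Lp_norm p M g powr p = (\<integral>\<omega>. norm (g \<omega>) powr p \<partial>M)"
  by (simp add: Lp_norm_def powr_powr integral_nonneg_AE)

lemma integrable_Lp_diff:
  fixes g h :: "'a \<Rightarrow> 'b::{real_normed_vector, second_countable_topology}"
  assumes "1 \<le> p" "g \<in> Lp_space p M" "h \<in> Lp_space p M"
  shows "integrable M (\<lambda>\<omega>. norm (g \<omega> - h \<omega>) powr p)"
proof (rule Bochner_Integration.integrable_bound)
  have [measurable]: "g \<in> borel_measurable M" "h \<in> borel_measurable M"
    using assms by (auto simp: Lp_space_def)
  show "integrable M (\<lambda>\<omega>. 2 powr (p - 1) * (norm (g \<omega>) powr p + norm (h \<omega>) powr p))"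
    using assms by (auto simp: Lp_space_def)
  show "(\<lambda>\<omega>. norm (g \<omega> - h \<omega>) powr p) \<in> borel_measurable M" by measurable
  have "norm (g \<omega> - h \<omega>) powr p \<le> 2 powr (p - 1) * (norm (g \<omega>) powr p + norm (h \<omega>) powr p)" for \<omega>
    using assms(1) by (intro order_trans[OF powr_mono2 powr_add_le] norm_triangle_ineq4) auto
  then show "AE \<omega> in M. norm (norm (g \<omega> - h \<omega>) powr p)
      \<le> norm (2 powr (p - 1) * (norm (g \<omega>) powr p + norm (h \<omega>) powr p))"
    by simp
qed

context
  fixes p :: real and n k m :: nat and M :: "'a measure"
    and f :: "(nat \<Rightarrow> int) \<Rightarrow> 'a \<Rightarrow> 'b::{real_normed_vector, second_countable_topology}"
  assumes p: "1 \<le> p" and m: "0 < m"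
    and f: "\<And>x. x \<in> carrier (torus n m) \<Longrightarrow> f x \<in> Lp_space p M"
begin

lemma integrable_increment:
  "x \<in> carrier (torus n m) \<Longrightarrow> integrable M (\<lambda>\<omega>. norm (f (torus_vec n m v) \<omega> - f x \<omega>) powr p)"
  by (intro integrable_Lp_diff p f torus_vec_in_carrier m)

lemma Xp_lhs_eq:
  "Xp_lhs p n k m M f = (\<integral>\<omega>. Xp_pow_lhs p n k m (\<lambda>x. f x \<omega>) \<partial>M) powr (1 / p)"
proof -
  have "(\<integral>\<omega>. Xp_pow_lhs p n k m (\<lambda>x. f x \<omega>) \<partial>M) = 1 / real (n choose k) *
      (\<Sum>S | S \<subseteq> {1..n} \<and> card S = k. avg (carrier (torus n m)) (\<lambda>x. avg (signs n) (\<lambda>\<epsilon>.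
       \<integral>\<omega>. norm (f (torus_vec n m (x + (\<lambda>j. 4 * int m * mix S \<epsilon> 0 j))) \<omega> - f x \<omega>) powr p \<partial>M)))"
    unfolding Xp_pow_lhs_def
    by (simp add: integral_avg integrable_avg integrable_increment cong: avg_cong)
  then show ?thesis
    using p by (simp add: Xp_lhs_def Lp_norm_powr avg_Times sign_vec_eq torus_pow torus_mult)
qed

lemma Xp_rhs_eq:
  "Xp_rhs p n k m M f = (\<integral>\<omega>. Xp_pow_rhs p n k m (\<lambda>x. f x \<omega>) \<partial>M) powr (1 / p)"
proof -
  have "(\<integral>\<omega>. Xp_pow_rhs p n k m (\<lambda>x. f x \<omega>) \<partial>M) =
     real k / real n * (\<Sum>j=1..n. avg (carrier (torus n m)) (\<lambda>x.
        \<integral>\<omega>. norm (f (torus_vec n m (x + (\<lambda>i. of_bool (i = j)))) \<omega> - f x \<omega>) powr p \<partial>M))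
     + (real k / real n) powr (p / 2) * avg (carrier (torus n m)) (\<lambda>x. avg (signs n) (\<lambda>\<epsilon>.
        \<integral>\<omega>. norm (f (torus_vec n m (x + \<epsilon>)) \<omega> - f x \<omega>) powr p \<partial>M))"
    unfolding Xp_pow_rhs_def
    by (simp add: integral_avg integrable_avg integrable_increment cong: avg_cong)
  then show ?thesis
    using p by (simp add: Xp_rhs_def Lp_norm_powr avg_Times sign_vec_full[unfolded One_nat_def] unit_vec_eq torus_mult)
qed

lemma integrable_Xp_pow:
  "integrable M (\<lambda>\<omega>. Xp_pow_lhs p n k m (\<lambda>x. f x \<omega>))"
  "integrable M (\<lambda>\<omega>. Xp_pow_rhs p n k m (\<lambda>x. f x \<omega>))"
proof -
  show "integrable M (\<lambda>\<omega>. Xp_pow_lhs p n k m (\<lambda>x. f x \<omega>))"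
    unfolding Xp_pow_lhs_def
    by (intro integrable_divide Bochner_Integration.integrable_sum integrable_avg integrable_increment)
  show "integrable M (\<lambda>\<omega>. Xp_pow_rhs p n k m (\<lambda>x. f x \<omega>))"
    unfolding Xp_pow_rhs_def
    by (intro Bochner_Integration.integrable_add integrable_mult_right
        Bochner_Integration.integrable_sum integrable_avg integrable_increment)
qed

text \<open>Both \<open>p\<close>-th powers are integrals of their scalar versions, so the scalar inequality at each
  point of the measure space can be integrated.\<close>

lemma Xp_le_of_scalar:
  assumes sc: "scalar_Xp TYPE('b) p K" and K: "0 \<le> K"
    and adm: "k \<in> {1..n} \<and> sqrt (real n / real k) \<le> real m"
  shows "Xp_lhs p n k m M f \<le> K * real m * Xp_rhs p n k m M f"
proof -
  let ?l = "\<lambda>\<omega>. Xp_pow_lhs p n k m (\<lambda>x. f x \<omega>)" and ?r = "\<lambda>\<omega>. Xp_pow_rhs p n k m (\<lambda>x. f x \<omega>)"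
  have "(\<integral>\<omega>. ?l \<omega> \<partial>M) \<le> (\<integral>\<omega>. (K * real m) powr p * ?r \<omega> \<partial>M)"
    using sc adm by (intro integral_mono integrable_Xp_pow integrable_mult_right)
      (auto simp: scalar_Xp_def)
  then have "(\<integral>\<omega>. ?l \<omega> \<partial>M) \<le> (K * real m) powr p * (\<integral>\<omega>. ?r \<omega> \<partial>M)" by simp
  then have "(\<integral>\<omega>. ?l \<omega> \<partial>M) powr (1 / p) \<le> ((K * real m) powr p * (\<integral>\<omega>. ?r \<omega> \<partial>M)) powr (1 / p)"
    using p by (intro powr_mono2) (auto intro: integral_nonneg_AE simp: Xp_pow_lhs_nonneg)
  also have "\<dots> = K * real m * (\<integral>\<omega>. ?r \<omega> \<partial>M) powr (1 / p)"
    using p K by (subst powr_mult) (auto intro: integral_nonneg_AE simp: Xp_pow_rhs_nonneg powr_powr)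
  finally show ?thesis unfolding Xp_lhs_eq Xp_rhs_eq .
qed

end

lemma metric_Xp_of_scalar:
  assumes "1 \<le> p" "0 \<le> K" "scalar_Xp TYPE(real) p K" "scalar_Xp TYPE(complex) p K"
  shows "metric_Xp TYPE('a) p K"
  unfolding metric_Xp_def
proof (intro allI impI conjI)
  fix n k m :: nat and M :: "'a measure"
  assume adm: "k \<in> {1..n} \<and> sqrt (real n / real k) \<le> real m"
  then have m: "0 < m" using admissible_pos by blast
  show "Xp_lhs p n k m M f \<le> K * real m * Xp_rhs p n k m M f"
    if "\<forall>x\<in>carrier (torus n m). f x \<in> Lp_space p M" for f :: "(nat \<Rightarrow> int) \<Rightarrow> 'a \<Rightarrow> real"
    by (rule Xp_le_of_scalar) (use assms adm m that in auto)
  show "Xp_lhs p n k m M f \<le> K * real m * Xp_rhs p n k m M f"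
    if "\<forall>x\<in>carrier (torus n m). f x \<in> Lp_space p M" for f :: "(nat \<Rightarrow> int) \<Rightarrow> 'a \<Rightarrow> complex"
    by (rule Xp_le_of_scalar) (use assms adm m that in auto)
qed

text \<open>Over a one-point measure space the Lebesgue space is the scalar field itself.\<close>

lemma scalar_of_point_mass:
  fixes f :: "(nat \<Rightarrow> int) \<Rightarrow> 'b::{real_normed_vector, second_countable_topology}"
  assumes p: "1 \<le> p" and K: "0 \<le> K" and m: "0 < m"
    and le: "Xp_lhs p n k m (count_space {0::real}) (\<lambda>x _. f x)
       \<le> K * real m * Xp_rhs p n k m (count_space {0::real}) (\<lambda>x _. f x)"
  shows "Xp_pow_lhs p n k m f \<le> (K * real m) powr p * Xp_pow_rhs p n k m f"
proof -
  have Lp: "(\<lambda>_. f x) \<in> Lp_space p (count_space {0::real})" for x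
    by (simp add: Lp_space_def integrable_count_space)
  have "Xp_pow_lhs p n k m f powr (1 / p) \<le> K * real m * Xp_pow_rhs p n k m f powr (1 / p)"
    using le unfolding Xp_lhs_eq[OF p m Lp] Xp_rhs_eq[OF p m Lp]
    by (simp add: lebesgue_integral_count_space_finite)
  then have "(Xp_pow_lhs p n k m f powr (1 / p)) powr p \<le> (K * real m * Xp_pow_rhs p n k m f powr (1 / p)) powr p"
    using p by (intro powr_mono2) auto
  also have "\<dots> = (K * real m) powr p * (Xp_pow_rhs p n k m f powr (1 / p)) powr p"
    by (rule powr_mult)
  finally show ?thesis
    using p Xp_pow_lhs_nonneg[of p n k m f] Xp_pow_rhs_nonneg[of p n k m f] by (simp add: powr_powr)
qed

lemma scalar_of_metric_Xp:
  assumes p: "1 \<le> p" and K: "0 \<le> K" and met: "metric_Xp TYPE(real) p K"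
  shows "scalar_Xp TYPE(real) p K" "scalar_Xp TYPE(complex) p K"
proof -
  have Lp: "(\<lambda>_. c) \<in> Lp_space p (count_space {0::real})" for c :: "'c::real_normed_vector"
    by (simp add: Lp_space_def integrable_count_space)
  show "scalar_Xp TYPE(real) p K" unfolding scalar_Xp_def
  proof (intro allI impI)
    fix n k m :: nat and f :: "(nat \<Rightarrow> int) \<Rightarrow> real"
    assume adm: "k \<in> {1..n} \<and> sqrt (real n / real k) \<le> real m"
    then have m: "0 < m" using admissible_pos by blast
    from met adm have "\<forall>f :: (nat \<Rightarrow> int) \<Rightarrow> real \<Rightarrow> real.
        (\<forall>x\<in>carrier (torus n m). f x \<in> Lp_space p (count_space {0})) \<longrightarrow>
        Xp_lhs p n k m (count_space {0}) f \<le> K * real m * Xp_rhs p n k m (count_space {0}) f"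
      unfolding metric_Xp_def by blast
    from this[rule_format, of "\<lambda>x _. f x"] Lp
    show "Xp_pow_lhs p n k m f \<le> (K * real m) powr p * Xp_pow_rhs p n k m f"
      by (intro scalar_of_point_mass[OF p K m]) blast
  qed
  show "scalar_Xp TYPE(complex) p K" unfolding scalar_Xp_def
  proof (intro allI impI)
    fix n k m :: nat and f :: "(nat \<Rightarrow> int) \<Rightarrow> complex"
    assume adm: "k \<in> {1..n} \<and> sqrt (real n / real k) \<le> real m"
    then have m: "0 < m" using admissible_pos by blast
    from met adm have "\<forall>f :: (nat \<Rightarrow> int) \<Rightarrow> real \<Rightarrow> complex.
        (\<forall>x\<in>carrier (torus n m). f x \<in> Lp_space p (count_space {0})) \<longrightarrow>
        Xp_lhs p n k m (count_space {0}) f \<le> K * real m * Xp_rhs p n k m (count_space {0}) f"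
      unfolding metric_Xp_def by blast
    from this[rule_format, of "\<lambda>x _. f x"] Lp
    show "Xp_pow_lhs p n k m f \<le> (K * real m) powr p * Xp_pow_rhs p n k m f"
      by (intro scalar_of_point_mass[OF p K m]) blast
  qed
qed

section \<open>Optimality of the order\<close>

text \<open>Unit steps change this function by at most \<open>1\<close>, but half a turn of the cycle changes it by an
  amount of order \<open>m\<close> at a fixed proportion of the points.\<close>

definition tent :: "nat \<Rightarrow> int \<Rightarrow> int"
  where "tent m a = \<bar>a mod int (8 * m) - 4 * int m\<bar>"

lemma tent_lipschitz: "0 < m \<Longrightarrow> \<bar>tent m (a + 1) - tent m a\<bar> \<le> 1" 
proof -
  assume m: "0 < m"
  define r where "r = a mod int (8 * m)"
  have r: "0 \<le> r" "r < int (8 * m)" using m by (simp_all add: r_def)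
  have "(a + 1) mod int (8 * m) = (r + 1) mod int (8 * m)" by (simp add: r_def mod_simps)
  also have "\<dots> = (if r + 1 = int (8 * m) then 0 else r + 1)" using r by auto
  finally show ?thesis using r m unfolding tent_def r_def[symmetric] by auto
qed

lemma tent_lipschitz': "0 < m \<Longrightarrow> \<bar>tent m (a - 1) - tent m a\<bar> \<le> 1"
  using tent_lipschitz[of m "a - 1"] by simp

text \<open>The sign \<open>s\<close> is immaterial, as \<open>4 * m\<close> is its own negative modulo \<open>8 * m\<close>.\<close>

lemma tent_antipode:
  assumes "4 * int m \<le> a" "a < 5 * int m" "s \<in> {-1, 1}"
  shows "tent m (a + 4 * int m * s) - tent m a \<ge> 2 * int m"
proof -
  have "(a + 4 * int m * s) mod int (8 * m) = a - 4 * int m"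
  proof (cases "s = 1")
    case True
    have "(a + 4 * int m) mod int (8 * m) = (a - 4 * int m + int (8 * m)) mod int (8 * m)"
      by (simp add: add.commute)
    also have "\<dots> = a - 4 * int m" unfolding mod_add_self2 using assms by (intro mod_pos_pos_trivial) auto
    finally show ?thesis using True by simp
  next
    case False
    then show ?thesis using assms by simp
  qed
  then show ?thesis using assms by (simp add: tent_def)
qed

definition tent_sum :: "nat \<Rightarrow> nat \<Rightarrow> (nat \<Rightarrow> int) \<Rightarrow> real"
  where "tent_sum N m x = (\<Sum>j=1..N. real_of_int (tent m (x j)))"

lemma tent_sum_torus_vec: "N \<le> n \<Longrightarrow> tent_sum N m (torus_vec n m v) = tent_sum N m v"
  unfolding tent_sum_def by (intro sum.cong) (auto simp: torus_vec_def tent_def)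

lemma tent_sum_rhs_le:
  assumes p: "1 \<le> p" and N: "0 < N" "N \<le> n" and m: "0 < m"
  shows "Xp_pow_rhs p n N m (tent_sum N m)
       \<le> real N / real n * real N + (real N / real n) powr (p / 2) * real N powr p"
proof -
  let ?X = "carrier (torus n m)"
  note X = finite_carrier_torus[OF m] carrier_torus_nonempty[OF m]
  have 1: "avg ?X (\<lambda>x. norm (tent_sum N m (torus_vec n m (x + (\<lambda>i. of_bool (i = j)))) - tent_sum N m x) powr p)
      \<le> of_bool (j \<le> N)" if j: "j \<in> {1..n}" for j
  proof (intro avg_le_const X)
    fix x
    have "tent_sum N m (x + (\<lambda>i. of_bool (i = j))) - tent_sum N m x
      = (\<Sum>i=1..N. of_bool (i = j) * real_of_int (tent m (x j + 1) - tent m (x j)))"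
      unfolding tent_sum_def sum_subtractf[symmetric] by (intro sum.cong) auto
    also have "\<dots> = of_bool (j \<le> N) * real_of_int (tent m (x j + 1) - tent m (x j))"
      using j by (simp add: of_bool_def sum.delta if_distrib[where f = "\<lambda>c. c * _"] cong: if_cong)
    finally have eq: "tent_sum N m (x + (\<lambda>i. of_bool (i = j))) - tent_sum N m x
       = of_bool (j \<le> N) * real_of_int (tent m (x j + 1) - tent m (x j))" .
    have "\<bar>real_of_int (tent m (x j + 1) - tent m (x j))\<bar> \<le> 1"
      using tent_lipschitz[OF m, of "x j"] by linarith
    then have "\<bar>real_of_int (tent m (x j + 1) - tent m (x j))\<bar> powr p \<le> 1"
      using p powr_mono2[of p _ 1] by fastforce
    then show "norm (tent_sum N m (torus_vec n m (x + (\<lambda>i. of_bool (i = j)))) - tent_sum N m x) powr p \<le> of_bool (j \<le> N)"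
      unfolding tent_sum_torus_vec[OF N(2)] eq by (cases "j \<le> N") auto
  qed
  have 2: "avg ?X (\<lambda>x. avg (signs n) (\<lambda>\<epsilon>. norm (tent_sum N m (torus_vec n m (x + \<epsilon>)) - tent_sum N m x) powr p))
      \<le> real N powr p"
  proof (intro avg_le_const X finite_signs signs_nonempty)
    fix x \<epsilon> assume e: "\<epsilon> \<in> signs n"
    have "\<bar>tent_sum N m (x + \<epsilon>) - tent_sum N m x\<bar> \<le> (\<Sum>j=1..N. \<bar>real_of_int (tent m (x j + \<epsilon> j)) - real_of_int (tent m (x j))\<bar>)"
      unfolding tent_sum_def sum_subtractf[symmetric] plus_fun_apply by (rule sum_abs)
    also have "\<dots> \<le> (\<Sum>j=1..N. 1)"
    proof (intro sum_mono)
      fix j assume "j \<in> {1..N}"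
      then have "\<epsilon> j = 1 \<or> \<epsilon> j = -1" using signs_cases[OF e, of j] N by auto
      then have "\<bar>tent m (x j + \<epsilon> j) - tent m (x j)\<bar> \<le> 1"
        using tent_lipschitz[OF m, of "x j"] tent_lipschitz'[OF m, of "x j"] by auto
      then show "\<bar>real_of_int (tent m (x j + \<epsilon> j)) - real_of_int (tent m (x j))\<bar> \<le> 1" by linarith
    qed
    finally show "norm (tent_sum N m (torus_vec n m (x + \<epsilon>)) - tent_sum N m x) powr p \<le> real N powr p"
      unfolding tent_sum_torus_vec[OF N(2)] using p by (intro powr_mono2) auto
  qed
  have "(\<Sum>j=1..n. avg ?X (\<lambda>x. norm (tent_sum N m (torus_vec n m (x + (\<lambda>i. of_bool (i = j)))) - tent_sum N m x) powr p))
     \<le> (\<Sum>j=1..n. of_bool (j \<le> N))" by (intro sum_mono 1)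
  also have "\<dots> = real (card {j \<in> {1..n}. j \<le> N})" by (simp add: of_bool_def sum.If_cases Int_def)
  also have "{j \<in> {1..n}. j \<le> N} = {1..N}" using N by auto
  finally show ?thesis
    unfolding Xp_pow_rhs_def using 2 by (intro add_mono mult_left_mono) (auto simp del: plus_fun_apply)
qed

text \<open>Keep only the term \<open>S = {1..N}\<close> and only those \<open>x\<close> whose first \<open>N\<close> coordinates lie in
  \<open>{4 * m..<5 * m}\<close>, a proportion \<open>(1 / 8) ^ N\<close> of all.  There every summand grows by at least
  \<open>2 * m\<close>, whatever the signs.\<close>

lemma tent_sum_lhs_ge:
  assumes p: "1 \<le> p" and N: "0 < N" "N \<le> n" and m: "0 < m"
  shows "(1 / 8) ^ N * (2 * real m * real N) powr p / real (n choose N) \<le> Xp_pow_lhs p n N m (tent_sum N m)"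
proof -
  let ?X = "carrier (torus n m)"
  let ?\<Delta> = "\<lambda>S x \<epsilon>. norm (tent_sum N m (torus_vec n m (x + (\<lambda>j. 4 * int m * mix S \<epsilon> 0 j))) - tent_sum N m x) powr p"
  define G where "G = (\<Pi>\<^sub>E j\<in>{1..n}. if j \<le> N then {4 * int m..<5 * int m} else {0..<int (8 * m)})"
  have GX: "G \<subseteq> ?X"
    unfolding G_def carrier_torus[OF m] by (rule PiE_mono) (auto split: if_splits)
  have card: "real (card G) / real (card ?X) = (1 / 8) ^ N"
  proof -
    have "card G = (\<Prod>j\<in>{1..n}. if j \<le> N then m else 8 * m)"
      unfolding G_def by (subst card_PiE) (auto intro!: prod.cong)
    also have "\<dots> = m ^ N * (8 * m) ^ (n - N)"
    proof -
      have "{1..n} \<inter> {j. j \<le> N} = {1..N}" "{1..n} \<inter> - {j. j \<le> N} = {N<..n}" using N by auto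
      then show ?thesis by (simp add: prod.If_cases)
    qed
    finally have g: "card G = m ^ N * (8 * m) ^ (n - N)" .
    have "card ?X = (8 * m) ^ n" unfolding carrier_torus[OF m]
      by (simp add: card_PiE nat_mult_distrib power_mult_distrib)
    also have "\<dots> = (8 * m) ^ N * (8 * m) ^ (n - N)" using N by (subst power_add[symmetric]) simp
    finally show ?thesis using m g by (simp add: power_mult_distrib power_one_over field_simps)
  qed
  have big: "(2 * real m * real N) powr p \<le> ?\<Delta> {1..N} x \<epsilon>" if x: "x \<in> G" and e: "\<epsilon> \<in> signs n" for x \<epsilon>
  proof -
    have "(\<Sum>j=1..N. 2 * real m) \<le> (\<Sum>j=1..N. real_of_int (tent m (x j + 4 * int m * mix {1..N} \<epsilon> 0 j)) - real_of_int (tent m (x j)))"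
    proof (rule sum_mono)
      fix j assume j: "j \<in> {1..N}"
      then have "x j \<in> {4 * int m..<5 * int m}" using x N PiE_mem[OF x[unfolded G_def], of j] by auto
      moreover have "mix {1..N} \<epsilon> 0 j \<in> {-1, 1}" using j signs_cases[OF e, of j] N by (auto simp: mix_def)
      ultimately have "2 * int m \<le> tent m (x j + 4 * int m * mix {1..N} \<epsilon> 0 j) - tent m (x j)"
        by (intro tent_antipode) auto
      then show "2 * real m \<le> real_of_int (tent m (x j + 4 * int m * mix {1..N} \<epsilon> 0 j)) - real_of_int (tent m (x j))"
        by linarith
    qed
    then have "2 * real m * real N \<le> tent_sum N m (x + (\<lambda>j. 4 * int m * mix {1..N} \<epsilon> 0 j)) - tent_sum N m x"
      by (simp add: tent_sum_def sum_subtractf mult.commute)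
    then show ?thesis
      unfolding tent_sum_torus_vec[OF N(2)] using p by (intro powr_mono2) auto
  qed
  have "(1 / 8) ^ N * (2 * real m * real N) powr p = (\<Sum>x\<in>G. (2 * real m * real N) powr p) / real (card ?X)"
    by (simp add: card[symmetric])
  also have "\<dots> \<le> (\<Sum>x\<in>G. avg (signs n) (?\<Delta> {1..N} x)) / real (card ?X)"
  proof (intro divide_right_mono sum_mono)
    fix x assume "x \<in> G"
    then have "avg (signs n) (\<lambda>_. (2 * real m * real N) powr p) \<le> avg (signs n) (?\<Delta> {1..N} x)"
      by (intro avg_mono big)
    then show "(2 * real m * real N) powr p \<le> avg (signs n) (?\<Delta> {1..N} x)" by (simp add: avg_const)
  qed auto
  also have "\<dots> \<le> avg ?X (\<lambda>x. avg (signs n) (?\<Delta> {1..N} x))"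
    unfolding avg_def[of ?X] using GX finite_carrier_torus[OF m]
    by (intro divide_right_mono sum_mono2) (auto intro: avg_nonneg)
  also have "\<dots> \<le> (\<Sum>S | S \<subseteq> {1..n} \<and> card S = N. avg ?X (\<lambda>x. avg (signs n) (?\<Delta> S x)))"
    using N by (intro member_le_sum[where f = "\<lambda>S. avg ?X (\<lambda>x. avg (signs n) (?\<Delta> S x))"])
      (auto intro!: avg_nonneg finite_subset[of _ "Pow {1..n}"])
  finally show ?thesis
    unfolding Xp_pow_lhs_def by (intro divide_right_mono) auto
qed

text \<open>With \<open>N\<close> close to \<open>p / ln p\<close>, both \<open>n choose N\<close> and \<open>8 ^ N\<close> are at most \<open>exp (6 * p)\<close>, the
  former because \<open>ln n\<close> is of order \<open>ln p\<close>.  Choosing \<open>n / k = q\<^sup>2\<close> with \<open>q \<ge> p\<close> keeps the right-hand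
  side bounded in spite of \<open>N\<close> being large, and allows \<open>m = q\<close>.\<close>

lemma scalar_Xp_lower:
  assumes p: "2 \<le> p" and K: "0 \<le> K" and sc: "scalar_Xp TYPE(real) p K"
  shows "exp (- 14) * (p / ln p) \<le> K"
proof -
  define N where "N = nat \<lfloor>p / ln p\<rfloor>"
  define q where "q = nat \<lceil>p\<rceil>"
  define n where "n = N * q\<^sup>2"
  have lnp: "0 < ln p" using p by simp
  have L1: "1 \<le> p / ln p" by (rule one_le_div_ln[OF p])
  have N1: "1 \<le> N" using L1 by (simp add: N_def le_nat_floor)
  have NL: "real N \<le> p / ln p" and LN: "p / ln p \<le> 2 * real N"
    using L1 N1 unfolding N_def by linarith+
  have q: "p \<le> real q" "real q \<le> 2 * p" "0 < q" using p unfolding q_def by linarith+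
  have N: "0 < N" "N \<le> n" using N1 q by (auto simp: n_def)
  have "1 / 2 \<le> ln (2::real)"
  proof -
    have "exp (1 / 2 :: real) ^ 2 \<le> 2 ^ 2"
      using exp_le by (simp flip: exp_of_nat_mult)
    then have "exp (1 / 2 :: real) \<le> 2" by (rule power2_le_imp_le) simp
    then show ?thesis by (metis exp_gt_zero ln_exp ln_le_cancel_iff zero_less_numeral)
  qed
  moreover have "ln 2 \<le> ln p" using p by simp
  ultimately have "1 / 2 \<le> ln p" by (rule order_trans)
  then have "p / ln p \<le> p / (1 / 2)" using p by (intro divide_left_mono) auto
  then have "p / ln p \<le> 2 * p" by simp
  then have N2p: "real N \<le> 2 * p" using NL by linarith
  have Nlnp: "real N * ln p \<le> p" using NL lnp by (simp add: field_simps)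
  define \<kappa> where "\<kappa> = real N / real n"
  have \<kappa>: "\<kappa> = 1 / (real q)\<^sup>2" using N1 by (simp add: \<kappa>_def n_def)
  have adm: "N \<in> {1..n} \<and> sqrt (real n / real N) \<le> real q"
    using N N1 by (simp add: n_def)
  have rhs: "Xp_pow_rhs p n N q (tent_sum N q) \<le> exp (2 * p)"
  proof -
    have "Xp_pow_rhs p n N q (tent_sum N q) \<le> \<kappa> * real N + \<kappa> powr (p / 2) * real N powr p"
      unfolding \<kappa>_def using p q by (intro tent_sum_rhs_le N) auto
    also have "\<kappa> * real N \<le> 2 powr p"
    proof -
      have "\<kappa> * real N \<le> 1 / (real q)\<^sup>2 * (2 * real q)"
        unfolding \<kappa> using N2p q by (intro mult_left_mono) auto
      also have "\<dots> \<le> 2" using q p by (simp add: power2_eq_square field_simps)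
      also have "\<dots> \<le> 2 powr p" using powr_mono[of 1 p 2] p by simp
      finally show ?thesis .
    qed
    also have "\<kappa> powr (p / 2) * real N powr p \<le> 2 powr p"
    proof -
      have "\<kappa> powr (p / 2) = (1 / real q) powr p"
        unfolding \<kappa> using q by (simp add: powr_divide powr_powr flip: powr_numeral)
      then have "\<kappa> powr (p / 2) * real N powr p = (real N / real q) powr p"
        by (simp add: powr_divide)
      also have "\<dots> \<le> 2 powr p"
        using N2p q p by (intro powr_mono2) (auto simp: field_simps)
      finally show ?thesis .
    qed
    also have "2 powr p + 2 powr p \<le> 2 powr p * 2 powr p"
      using powr_mono[of 1 p 2] p by (simp add: mult_right_mono flip: mult_2)
    also have "\<dots> = 4 powr p" by (simp flip: powr_mult)
    also have "\<dots> \<le> exp 2 powr p"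
    proof (intro powr_mono2)
      have "(2::real) ^ 2 \<le> exp 1 ^ 2" using exp_ge_add_one_self[of 1] by (intro power_mono) auto
      then show "(4::real) \<le> exp 2" by (simp flip: exp_of_nat_mult)
    qed (use p in auto)
    finally show ?thesis by (simp add: powr_def mult.commute)
  qed
  have lhs: "exp (- 12 * p) * (real q * (p / ln p)) powr p \<le> Xp_pow_lhs p n N q (tent_sum N q)"
  proof -
    have "(n choose N) \<le> n ^ N" by (rule binomial_le_pow) (rule N)
    then have "real (n choose N) \<le> real n ^ N" by (metis of_nat_le_iff of_nat_power)
    also have "\<dots> \<le> ((2 * p) ^ 3) ^ N"
    proof (intro power_mono)
      have "real n = real N * (real q * real q)" by (simp add: n_def power2_eq_square)
      also have "\<dots> \<le> 2 * p * (2 * p * (2 * p))"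
        using N2p q p by (intro mult_mono) auto
      finally show "real n \<le> (2 * p) ^ 3" by (simp add: power3_eq_cube)
    qed auto
    also have "\<dots> \<le> ((p ^ 2) ^ 3) ^ N"
      using p by (intro power_mono) (auto simp: power2_eq_square)
    also have "\<dots> = exp (ln p) ^ (6 * N)" using p by (simp add: power_mult)
    also have "\<dots> = exp (6 * (real N * ln p))" by (simp add: exp_of_nat_mult[symmetric] mult.assoc)
    also have "\<dots> \<le> exp (6 * p)" using Nlnp by simp
    finally have binom: "real (n choose N) \<le> exp (6 * p)" .
    have "(2::real) ^ 3 \<le> exp 1 ^ 3" using exp_ge_add_one_self[of 1] by (intro power_mono) auto
    then have "(8::real) \<le> exp 3" by (simp flip: exp_of_nat_mult)
    then have "(8::real) ^ N \<le> exp 3 ^ N" by (intro power_mono) auto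
    also have "\<dots> = exp (3 * real N)" by (simp add: exp_of_nat_mult[symmetric] mult.commute)
    also have "\<dots> \<le> exp (6 * p)" using N2p by simp
    finally have eight: "(8::real) ^ N \<le> exp (6 * p)" .
    have "exp (- 12 * p) * (real q * (p / ln p)) powr p
        = (real q * (p / ln p)) powr p / (exp (6 * p) * exp (6 * p))"
      by (simp add: exp_minus field_simps flip: exp_add)
    also have "\<dots> \<le> (2 * real q * real N) powr p / (8 ^ N * real (n choose N))"
    proof (rule frac_le)
      have "real q * (p / ln p) \<le> real q * (2 * real N)" using LN by (rule mult_left_mono) simp
      then show "(real q * (p / ln p)) powr p \<le> (2 * real q * real N) powr p"
        using p by (intro powr_mono2) (auto simp: mult_ac)
      show "8 ^ N * real (n choose N) \<le> exp (6 * p) * exp (6 * p)"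
        by (intro mult_mono binom eight) auto
    qed (use N in auto)
    also have "\<dots> = (1 / 8) ^ N * (2 * real q * real N) powr p / real (n choose N)"
      by (simp add: power_one_over field_simps)
    also have "\<dots> \<le> Xp_pow_lhs p n N q (tent_sum N q)"
      using p q by (intro tent_sum_lhs_ge N) auto
    finally show ?thesis .
  qed
  have "exp (- 12 * p) * (real q * (p / ln p)) powr p \<le> (K * real q) powr p * exp (2 * p)"
  proof -
    note lhs
    also have "Xp_pow_lhs p n N q (tent_sum N q) \<le> (K * real q) powr p * Xp_pow_rhs p n N q (tent_sum N q)"
      using sc adm by (simp add: scalar_Xp_def)
    also have "\<dots> \<le> (K * real q) powr p * exp (2 * p)" by (intro mult_left_mono rhs) auto
    finally show ?thesis .
  qed
  then have "exp (12 * p) * (exp (- 12 * p) * (real q * (p / ln p)) powr p) \<le> exp (12 * p) * ((K * real q) powr p * exp (2 * p))"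
    by (rule mult_left_mono) simp
  moreover have "exp (12 * p) * (exp (- 12 * p) * Z) = Z" for Z by (simp add: exp_minus)
  moreover have "exp (14 * p) = exp (12 * p) * exp (2 * p)" by (simp flip: exp_add)
  then have "exp (12 * p) * (Z * exp (2 * p)) = exp (14 * p) * Z" for Z by (simp add: mult_ac)
  ultimately have "(real q * (p / ln p)) powr p \<le> exp (14 * p) * (K * real q) powr p" by (simp only:)
  also have "\<dots> = (exp 14 * (K * real q)) powr p"
    unfolding powr_mult by (simp add: powr_def mult.commute)
  finally have "real q * (p / ln p) \<le> exp 14 * (K * real q)"
    using p K q L1 powr_less_mono2[of p "exp 14 * (K * real q)" "real q * (p / ln p)"] by force
  then have "real q * (p / ln p) \<le> real q * (exp 14 * K)" by (simp only: mult_ac)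
  then have "p / ln p \<le> exp 14 * K" using q by (simp only: mult_le_cancel_left_pos of_nat_0_less_iff)
  then have "exp (- 14) * (p / ln p) \<le> exp (- 14) * (exp 14 * K)" by (intro mult_left_mono) auto
  then show ?thesis by (simp add: mult.assoc[symmetric] mult_exp_exp)
qed

section \<open>Upper bound, lower bound and transfer\<close>

theorem theorem1p3:
  shows "(\<exists>C>0::real. \<forall>p\<ge>2::real. metric_Xp TYPE(real) p (C * (p / ln p)))
    \<and> (\<exists>c>0::real. \<forall>p\<ge>2::real. \<forall>K\<ge>0::real.
          metric_Xp TYPE(real) p K \<longrightarrow> K \<ge> c * (p / ln p))
    \<and> (\<forall>p\<ge>2::real. \<forall>K\<ge>0::real. metric_Xp TYPE(real) p K \<longrightarrow> metric_Xp TYPE('a) p K)"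
proof (intro conjI)
  have "metric_Xp TYPE(real) p (1152 * (p / ln p))" if p: "2 \<le> p" for p
  proof -
    have K: "0 \<le> 576 * (p / ln p)" using p by simp
    have re: "scalar_Xp TYPE(real) p (576 * (p / ln p))" by (rule scalar_Xp_real[OF p])
    have eq: "2 * (576 * (p / ln p)) = 1152 * (p / ln p)" by simp
    have co: "scalar_Xp TYPE(complex) p (1152 * (p / ln p))"
      unfolding eq[symmetric] using p by (intro scalar_Xp_complex K re) auto
    have "scalar_Xp TYPE(real) p (1152 * (p / ln p))"
      using p by (intro scalar_Xp_mono[OF _ K _ re] mult_right_mono) auto
    then show ?thesis using p by (intro metric_Xp_of_scalar co) auto
  qed
  then show "\<exists>C>0::real. \<forall>p\<ge>2::real. metric_Xp TYPE(real) p (C * (p / ln p))"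
    by (intro exI[of _ "1152::real"]) auto
  have "exp (- 14) * (p / ln p) \<le> K"
    if "2 \<le> p" "0 \<le> K" "metric_Xp TYPE(real) p K" for p K
    using that by (intro scalar_Xp_lower scalar_of_metric_Xp) auto
  then show "\<exists>c>0::real. \<forall>p\<ge>2::real. \<forall>K\<ge>0::real.
          metric_Xp TYPE(real) p K \<longrightarrow> K \<ge> c * (p / ln p)"
    by (intro exI[of _ "exp (- 14)"]) auto
  show "\<forall>p\<ge>2::real. \<forall>K\<ge>0::real. metric_Xp TYPE(real) p K \<longrightarrow> metric_Xp TYPE('a) p K"
    using scalar_of_metric_Xp by (intro allI impI metric_Xp_of_scalar) auto
qed

end
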